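(* Let $\{\hat x_t\}$ be the average iterates produced by the averaged decision-dependent proximal stochastic gradient method with constant step size $\eta_t\equiv\eta$, $0<\eta\le1/(2L)$. Suppose that the regularizers $r_t\equiv r$ are identical for all $t$ and that there exist constants $\bar\Delta,\sigma>0$ such that for all $0\le i<t$: (i) $\mathbb{E}[\exp(\lambda\bar G_{i,t}^2)]\le\exp(\lambda(\hat\mu\bar\Delta|i-t|)^2)$ for all $0\le\lambda\le(\hat\mu\bar\Delta|i-t|)^{-2}$; (ii) with $\mathcal{F}_{i,t}:=\sigma(\mathcal{F}_i,\bar x_t)$, $\mathbb{E}[z_i\mid\mathcal{F}_{i,t}]=0$ and $\mathbb{P}\{\|z_i\|\ge\tau\mid\mathcal{F}_{i,t}\}\le2\exp(-2\tau^2/\sigma^2)$ for all $\tau>0$. Then there is an absolute constant $c>0$ such that for any specified $t\in\mathbb{N}$ and $\delta\in(0,1)$, the following estimate holds with probability at least $1-\delta$: $$\psi_t(\hat x_t)-\psi_t^\star\le c\left(\left(1-\tfrac{\hat\mu\eta}{2}\right)^t\left(\psi_0(x_0)-\psi_0^\star\right)+\eta\sigma^2+\frac{\bar\Delta^2}{\hat\mu\eta^2}\right)\log\left(\frac e\delta\right).$$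
   Context: Notation: $\mathbb{N}=\{0,1,2,\dots\}$; $\mathbb{R}^d$ carries the Euclidean inner product $\langle\cdot,\cdot\rangle$ and norm $\|\cdot\|$. An absolute constant is a numerical constant independent of all problem parameters. Problem family. For each $t\in\mathbb{N}$ and $x\in\mathbb{R}^d$, $f_{t,x}\colon\mathbb{R}^d\to\mathbb{R}$ is $\mu$-strongly convex and $C^1$-smooth with $L$-Lipschitz gradient, for common constants $\mu,L>0$; $\nabla f_{t,x}(u)$ denotes the gradient of $f_{t,x}(\cdot)$ at $u$. For each $t$, $r_t\colon\mathbb{R}^d\to\mathbb{R}\cup\{\infty\}$ is proper, closed, convex. Set $$\gamma:=\sup_{t\in\mathbb{N},\,u,x,y\in\mathbb{R}^d,\,x\ne y}\frac{\|\nabla f_{t,x}(u)-\nabla f_{t,y}(u)\|}{\|x-y\|},$$ and assume $\gamma<\mu/2$. Set $\bar\mu:=\mu-\gamma$ and $\hat\mu:=\mu-2\gamma>0$. The functions may be random (the problem may evolve stochastically), with these conditions holding for every outcome with deterministic $\mu,L,\gamma$. The temporal gradient drift is the random variable $\bar G_{i,t}:=\sup_{u,x\in\mathbb{R}^d}\|\nabla f_{i,x}(u)-\nabla f_{t,x}(u)\|$. Equilibria. For each $t$ there is a unique point $\bar x_t$ with $\bar x_t\in\operatorname{argmin}_{u\in\mathbb{R}^d}\{f_{t,\bar x_t}(u)+r_t(u)\}$. Set $\psi_t:=f_{t,\bar x_t}+r_t$ and $\psi_t^\star:=\min\psi_t=\psi_t(\bar x_t)$. Algorithm (averaged decision-dependent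 proximal stochastic gradient method). Given $x_0=\hat x_0$ and step sizes $\eta_t\in(0,1/\bar\mu)$, at each step $t\ge0$ a stochastic gradient $g_t$ (estimator of $\nabla f_{t,x_t}(x_t)$) is obtained and $$x_{t+1}=\operatorname{prox}_{\eta_t r_t}(x_t-\eta_t g_t)=\operatorname{argmin}_{u}\left\{r_t(u)+\tfrac{1}{2\eta_t}\|u-(x_t-\eta_t g_t)\|^2\right\},\qquad \hat x_{t+1}=\left(1-\tfrac{\hat\mu\eta_t}{2-\mu\eta_t}\right)\hat x_t+\tfrac{\hat\mu\eta_t}{2-\mu\eta_t}x_{t+1}.$$ The gradient noise is $z_t:=\nabla f_{t,x_t}(x_t)-g_t$. Stochastic framework. There is a probability space $(\Omega,\mathcal{F},\mathbb{P})$ with filtration $(\mathcal{F}_t)_{t\ge0}$, $\mathcal{F}_0=\{\emptyset,\Omega\}$, such that for all $t\ge0$: $x_t,\bar x_t\colon\Omega\to\mathbb{R}^d$ are $\mathcal{F}_t$-measurable, and $z_t\colon\Omega\to\mathbb{R}^d$ is $\mathcal{F}_{t+1}$-measurable with $\mathbb{E}[z_t\mid\mathcal{F}_t]=0$. Consistently with $\mathcal{F}_0$ being trivial, the initial gap $\psi_0(x_0)-\psi_0^\star$ is deterministic. All quantities whose probabilities or expectations are considered are understood to be random variables. *)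

theory Defs
  imports "HOL-Probability.Probability"
begin

definition grad :: "('a::euclidean_space \<Rightarrow> real) \<Rightarrow> 'a \<Rightarrow> 'a" where
  "grad h u = (THE D. GDERIV h u :> D)"

text \<open>The \<open>C\<close>-one property is implied: a function with a Lipschitz gradient is continuously
  differentiable.\<close>
definition smooth_with :: "real \<Rightarrow> ('a::euclidean_space \<Rightarrow> real) \<Rightarrow> bool" where
  "smooth_with L h \<longleftrightarrow> (\<forall>u. GDERIV h u :> grad h u) \<and> L-lipschitz_on UNIV (grad h)"

definition strongly_convex :: "real \<Rightarrow> ('a::euclidean_space \<Rightarrow> real) \<Rightarrow> bool" where
  "strongly_convex \<mu> h \<longleftrightarrow> convex_on UNIV (\<lambda>u. h u - \<mu> / 2 * (norm u)\<^sup>2)"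

text \<open>Closedness and convexity of an extended-valued function are those of its epigraph, a
  subset of \<open>'a \<times> real\<close>.\<close>
definition proper_closed_convex :: "('a::euclidean_space \<Rightarrow> ereal) \<Rightarrow> bool" where
  "proper_closed_convex \<rho> \<longleftrightarrow>
     (\<forall>u. \<rho> u \<noteq> - \<infinity>) \<and> (\<exists>u. \<rho> u \<noteq> \<infinity>) \<and>
     closed {(u, a::real). \<rho> u \<le> ereal a} \<and> convex {(u, a::real). \<rho> u \<le> ereal a}"

definition prox :: "real \<Rightarrow> ('a::euclidean_space \<Rightarrow> ereal) \<Rightarrow> 'a \<Rightarrow> 'a" where
  "prox \<eta> \<rho> v = arg_min (\<lambda>u. \<rho> u + ereal (1 / (2 * \<eta>) * (norm (u - v))\<^sup>2)) (\<lambda>_. True)"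

text \<open>Throughout, \<open>f \<omega> t x u\<close> is the value at \<open>u\<close> of the loss at time \<open>t\<close> with decision parameter
  \<open>x\<close> in outcome \<open>\<omega>\<close>, and \<open>r \<omega> t u\<close> the value of the regularizer.

  The supremum also ranges over the outcomes; if the supremum for each single outcome is the same
  deterministic number, then this is that number.\<close>
definition gradient_sensitivity ::
    "'w set \<Rightarrow> ('w \<Rightarrow> nat \<Rightarrow> 'a::euclidean_space \<Rightarrow> 'a \<Rightarrow> real) \<Rightarrow> ereal" where
  "gradient_sensitivity \<Omega> f =
     (SUP \<omega>\<in>\<Omega>. SUP t. SUP u. SUP x. SUP y\<in>-{x}.
        ereal (norm (grad (f \<omega> t x) u - grad (f \<omega> t y) u) / norm (x - y)))"

definition gradient_drift ::
    "('w \<Rightarrow> nat \<Rightarrow> 'a::euclidean_space \<Rightarrow> 'a \<Rightarrow> real) \<Rightarrow> nat \<Rightarrow> nat \<Rightarrow> 'w \<Rightarrow> ennreal" where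
  "gradient_drift f i t \<omega> =
     (SUP u. SUP x. ennreal (norm (grad (f \<omega> i x) u - grad (f \<omega> t x) u)))"

definition exp_ennreal :: "ennreal \<Rightarrow> ennreal" where
  "exp_ennreal a = (if a = \<infinity> then \<infinity> else ennreal (exp (enn2real a)))"

definition equilibrium ::
    "(nat \<Rightarrow> 'a::euclidean_space \<Rightarrow> 'a \<Rightarrow> real) \<Rightarrow> (nat \<Rightarrow> 'a \<Rightarrow> ereal) \<Rightarrow> nat \<Rightarrow> 'a \<Rightarrow> bool" where
  "equilibrium f r t y \<longleftrightarrow> is_arg_min (\<lambda>u. ereal (f t y u) + r t u) (\<lambda>_. True) y"

definition equilibrium_objective ::
    "('w \<Rightarrow> nat \<Rightarrow> 'a::euclidean_space \<Rightarrow> 'a \<Rightarrow> real) \<Rightarrow> ('w \<Rightarrow> nat \<Rightarrow> 'a \<Rightarrow> ereal) \<Rightarrow>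
     (nat \<Rightarrow> 'w \<Rightarrow> 'a) \<Rightarrow> nat \<Rightarrow> 'w \<Rightarrow> 'a \<Rightarrow> ereal" where
  "equilibrium_objective f r xbar t \<omega> u = ereal (f \<omega> t (xbar t \<omega>) u) + r \<omega> t u"

text \<open>The subtracted minimal value is finite, so this difference is never of the form
  \<open>\<infinity> - \<infinity>\<close>; the gap is \<open>\<infinity>\<close> where the regularizer is.\<close>
definition equilibrium_gap ::
    "('w \<Rightarrow> nat \<Rightarrow> 'a::euclidean_space \<Rightarrow> 'a \<Rightarrow> real) \<Rightarrow> ('w \<Rightarrow> nat \<Rightarrow> 'a \<Rightarrow> ereal) \<Rightarrow>
     (nat \<Rightarrow> 'w \<Rightarrow> 'a) \<Rightarrow> (nat \<Rightarrow> 'w \<Rightarrow> 'a) \<Rightarrow> nat \<Rightarrow> 'w \<Rightarrow> ereal" where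
  "equilibrium_gap f r xbar y t \<omega> =
     equilibrium_objective f r xbar t \<omega> (y t \<omega>) - equilibrium_objective f r xbar t \<omega> (xbar t \<omega>)"

definition gradient_noise ::
    "('w \<Rightarrow> nat \<Rightarrow> 'a::euclidean_space \<Rightarrow> 'a \<Rightarrow> real) \<Rightarrow> (nat \<Rightarrow> 'w \<Rightarrow> 'a) \<Rightarrow>
     (nat \<Rightarrow> 'w \<Rightarrow> 'a) \<Rightarrow> nat \<Rightarrow> 'w \<Rightarrow> 'a" where
  "gradient_noise f x g t \<omega> = grad (f \<omega> t (x t \<omega>)) (x t \<omega>) - g t \<omega>"

text \<open>Conditional expectation of a vector-valued random variable, coordinatewise.\<close>
definition vec_cond_exp :: "'w measure \<Rightarrow> 'w measure \<Rightarrow> ('w \<Rightarrow> 'a::euclidean_space) \<Rightarrow> 'w \<Rightarrow> 'a" where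
  "vec_cond_exp M G Z \<omega> = (\<Sum>b\<in>Basis. real_cond_exp M G (\<lambda>\<omega>'. Z \<omega>' \<bullet> b) \<omega> *\<^sub>R b)"

definition conditional_prob :: "'w measure \<Rightarrow> 'w measure \<Rightarrow> 'w set \<Rightarrow> 'w \<Rightarrow> real" where
  "conditional_prob M G A = real_cond_exp M G (indicator A)"

text \<open>The \<open>\<sigma>\<close>-algebra generated by \<open>G\<close> together with the random variable \<open>Y\<close>.\<close>
definition sigma_join :: "'w measure \<Rightarrow> ('w \<Rightarrow> 'a::topological_space) \<Rightarrow> 'w measure" where
  "sigma_join G Y = sigma (space G) (sets G \<union> sets (vimage_algebra (space G) Y borel))"

text \<open>The equilibrium \<open>xbar t \<omega>\<close> is unique because \<open>\<gamma> < \<mu>\<close>, so the equilibrium assumption determines it.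
  The last two assumptions on the drift and on the gap make explicit that they are random
  variables.\<close>
locale averaged_decision_dependent_psg =
  prob_space M + filtration "space M" F
  for M :: "'w measure" and F :: "nat \<Rightarrow> 'w measure" +
  fixes \<mu> L \<gamma> :: real
    and f :: "'w \<Rightarrow> nat \<Rightarrow> 'a::euclidean_space \<Rightarrow> 'a \<Rightarrow> real"
    and r :: "'w \<Rightarrow> nat \<Rightarrow> 'a \<Rightarrow> ereal"
    and \<eta> :: "nat \<Rightarrow> real"
    and x xhat xbar g :: "nat \<Rightarrow> 'w \<Rightarrow> 'a"
  assumes mu_pos: "0 < \<mu>" and L_pos: "0 < L"
    and loss_strongly_convex: "\<And>\<omega> t y. \<omega> \<in> space M \<Longrightarrow> strongly_convex \<mu> (f \<omega> t y)"
    and loss_smooth: "\<And>\<omega> t y. \<omega> \<in> space M \<Longrightarrow> smooth_with L (f \<omega> t y)"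
    and regularizer: "\<And>\<omega> t. \<omega> \<in> space M \<Longrightarrow> proper_closed_convex (r \<omega> t)"
    and gamma_eq: "ereal \<gamma> = gradient_sensitivity (space M) f"
    and gamma_less: "\<gamma> < \<mu> / 2"
    and xbar_equilibrium: "\<And>\<omega> t. \<omega> \<in> space M \<Longrightarrow> equilibrium (f \<omega>) (r \<omega>) t (xbar t \<omega>)"
    and step_size: "\<And>t. 0 < \<eta> t \<and> \<eta> t < 1 / (\<mu> - \<gamma>)"
    and xhat_0: "\<And>\<omega>. \<omega> \<in> space M \<Longrightarrow> xhat 0 \<omega> = x 0 \<omega>"
    and x_Suc: "\<And>\<omega> t. \<omega> \<in> space M \<Longrightarrow>
          x (Suc t) \<omega> = prox (\<eta> t) (r \<omega> t) (x t \<omega> - \<eta> t *\<^sub>R g t \<omega>)"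
    and xhat_Suc: "\<And>\<omega> t. \<omega> \<in> space M \<Longrightarrow>
          xhat (Suc t) \<omega> =
            (1 - (\<mu> - 2 * \<gamma>) * \<eta> t / (2 - \<mu> * \<eta> t)) *\<^sub>R xhat t \<omega> +
            ((\<mu> - 2 * \<gamma>) * \<eta> t / (2 - \<mu> * \<eta> t)) *\<^sub>R x (Suc t) \<omega>"
    and subalgebra: "\<And>t. subalgebra M (F t)"
    and F_0: "sets (F 0) = {{}, space M}"
    and x_measurable: "\<And>t. x t \<in> borel_measurable (F t)"
    and xbar_measurable: "\<And>t. xbar t \<in> borel_measurable (F t)"
    and noise_measurable: "\<And>t. gradient_noise f x g t \<in> borel_measurable (F (Suc t))"
    and noise_integrable: "\<And>t. integrable M (gradient_noise f x g t)"
    and noise_unbiased: "\<And>t. AE \<omega> in M. vec_cond_exp M (F t) (gradient_noise f x g t) \<omega> = 0"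
    and initial_gap_deterministic:
          "\<exists>D. \<forall>\<omega>\<in>space M. equilibrium_gap f r xbar x 0 \<omega> = D"
    and drift_measurable: "\<And>i t. gradient_drift f i t \<in> borel_measurable M"
    and gap_measurable: "\<And>t. equilibrium_gap f r xbar xhat t \<in> borel_measurable M"

text \<open>Absolute constants: a constant obtained by an outermost \<open>\<exists>c\<close> may still depend on the types of
  decisions (hence on the dimension) and of outcomes, since HOL has no quantification over types.
  Existence of an absolute constant is therefore stated with a numerical upper bound on \<open>c\<close>
  that does not mention these types.\<close>

end

theory Submission
  imports Defs
begin

text \<open>Fix \<open>t\<close> and measure progress towards \<open>xbar t\<close> alone. With \<open>\<rho> = (\<mu> - 2\<gamma>)\<eta> / (2 - \<mu>\<eta>)\<close>, the potential
  \<open>V i\<close>, the gap of \<open>xhat i\<close> for the objective at time \<open>t\<close> plus \<open>(\<mu> - 2\<gamma>)/4\<close> times the squared distance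
  from \<open>x i\<close> to \<open>xbar t\<close>, satisfies \<open>V (i+1) \<le> (1 - \<rho>) V i + \<rho> N i\<close>, where \<open>N i\<close> is the sum of
  \<open>\<langle>z i, x i - xbar t\<rangle>\<close>, \<open>\<eta> \<parallel>z i\<parallel>\<^sup>2\<close> and the squared drift divided by \<open>\<mu> - 2\<gamma>\<close>. Unrolling with the weights
  \<open>(2 - (1 - \<rho>)^k) (1 - \<rho>)^k\<close> instead of \<open>(1 - \<rho>)^k\<close> costs only a factor \<open>2\<close> on the initial term but
  leaves a negative multiple of each \<open>V i\<close>. This absorbs the conditional variance of the martingale part,
  whose exponential compensated by that variance has expectation at most \<open>1\<close>. The noise, squared noise,
  drift and initial drift parts are combined by convexity of \<open>exp\<close>, without any independence between them,
  and Markov's inequality concludes.\<close>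

subsection \<open>Strongly convex and smooth functions\<close>

text \<open>The comparison point \<open>xbar t\<close> is random and not yet known at time
  \<open>i < t\<close>. The noise is therefore taken to be centred and sub-Gaussian given
  \<open>F i\<close> joined with \<open>xbar t\<close>, which makes \<open>x i - xbar t\<close> a
  predictable multiplier of \<open>z i\<close>. This multiplier is unbounded and not controlled in
  advance: with k = t - 1 - i, the conditional variance at step i has order \<sigma>^2 \<rho>^2 (1 -
  \<rho>)^(2k) times the squared distance. A term that pays for it must decay like (1 - \<rho>)^(2k)
  too, and subtracting (1 - \<rho>)^(2k) from 2 (1 - \<rho>)^k produces such a term. Since \<rho> is
  at most a multiple of (\<mu> - 2\<gamma>)\<eta>, the price is a deviation scale of order
  \<eta>\<sigma>^2, uniformly in t. The drift over k + 1 steps grows linearly in k; the second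
  moment of the geometric weights has order 1/\<rho>^2 and turns its square into \<Delta>^2 /
  ((\<mu> - 2\<gamma>)\<eta>^2).\<close>

lemma norm_convex_combination_sq:
  fixes y u :: "'a::real_inner"
  shows "(norm ((1 - s) *\<^sub>R y + s *\<^sub>R u))\<^sup>2
    = (1 - s) * (norm y)\<^sup>2 + s * (norm u)\<^sup>2 - s * (1 - s) * (norm (u - y))\<^sup>2"
  unfolding power2_norm_eq_inner
  by (simp add: inner_simps inner_commute algebra_simps power2_eq_square)

lemma strongly_convexD:
  assumes "strongly_convex m q" "0 \<le> s" "s \<le> 1"
  shows "q ((1 - s) *\<^sub>R y + s *\<^sub>R u)
    \<le> (1 - s) * q y + s * q u - m / 2 * s * (1 - s) * (norm (u - y))\<^sup>2"
proof -
  have "q ((1 - s) *\<^sub>R y + s *\<^sub>R u) - m / 2 * (norm ((1 - s) *\<^sub>R y + s *\<^sub>R u))\<^sup>2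
     \<le> (1 - s) * (q y - m / 2 * (norm y)\<^sup>2) + s * (q u - m / 2 * (norm u)\<^sup>2)"
    using assms convex_onD[of UNIV "\<lambda>u. q u - m / 2 * (norm u)\<^sup>2" s y u]
    unfolding strongly_convex_def by simp
  then have "q ((1 - s) *\<^sub>R y + s *\<^sub>R u)
     \<le> (1 - s) * (q y - m / 2 * (norm y)\<^sup>2) + s * (q u - m / 2 * (norm u)\<^sup>2)
        + m / 2 * ((1 - s) * (norm y)\<^sup>2 + s * (norm u)\<^sup>2 - s * (1 - s) * (norm (u - y))\<^sup>2)"
    unfolding norm_convex_combination_sq by linarith
  also have "\<dots> = (1 - s) * q y + s * q u - m / 2 * s * (1 - s) * (norm (u - y))\<^sup>2"
    by (simp add: field_simps)
  finally show ?thesis .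
qed

text \<open>Let \<open>s\<close> tend to 0 from the right. This removes the factor
  \<open>1 - s\<close> that is left when a minimizer is compared with nearby points of a
  segment.\<close>

lemma le_of_forall_scaled_le:
  fixes a b c :: real
  assumes "\<And>s. 0 < s \<Longrightarrow> s < 1 \<Longrightarrow> a + (1 - s) * c \<le> b"
  shows "a + c \<le> b"
proof (rule tendsto_upperbound)
  show "((\<lambda>s. a + (1 - s) * c) \<longlongrightarrow> a + c) (at_right 0)"
    by (auto intro!: tendsto_eq_intros)
  show "eventually (\<lambda>s. a + (1 - s) * c \<le> b) (at_right 0)"
    unfolding eventually_at_right_field using assms by (auto intro!: exI[of _ 1])
qed auto

text \<open>Comparing \<open>y\<close> with the point at fraction \<open>s\<close> towards
  \<open>u\<close> gains a term of order \<open>s\<close> from strong convexity of \<open>q\<close>;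
  dividing by \<open>s\<close> and letting it tend to 0 gives the claim. This stands in for
  first-order optimality, so that no subgradients of the regularizer appear.\<close>

lemma quadratic_growth:
  assumes q: "strongly_convex m q" and h: "convex_on S h" and y: "y \<in> S" and u: "u \<in> S"
    and min: "\<And>v. v \<in> S \<Longrightarrow> q y + h y \<le> q v + h v"
  shows "q y + h y + m / 2 * (norm (u - y))\<^sup>2 \<le> q u + h u"
proof (rule le_of_forall_scaled_le)
  fix s :: real assume s: "0 < s" "s < 1"
  let ?w = "(1 - s) *\<^sub>R y + s *\<^sub>R u"
  have S: "convex S" using h by (rule convex_on_imp_convex)
  have w: "?w \<in> S" using convexD_alt[OF S y u, of s] s by simp
  have "q y + h y \<le> q ?w + h ?w" by (rule min[OF w])
  also have "q ?w \<le> (1 - s) * q y + s * q u - m / 2 * s * (1 - s) * (norm (u - y))\<^sup>2"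
    using strongly_convexD[OF q] s by simp
  also have "h ?w \<le> (1 - s) * h y + s * h u" using convex_onD[OF h _ _ y u, of s] s by simp
  finally have "s * (q y + h y + (1 - s) * (m / 2 * (norm (u - y))\<^sup>2)) \<le> s * (q u + h u)"
    by (simp add: algebra_simps)
  then show "q y + h y + (1 - s) * (m / 2 * (norm (u - y))\<^sup>2) \<le> q u + h u"
    using s by simp
qed

text \<open>Subtracting \<open>c\<close> times the squared norm leaves an affine function. With
  \<open>c = 1 / (2 * \<eta>)\<close> the proximal objective grows quadratically around the new
  iterate.\<close>

lemma strongly_convex_dist_sq:
  fixes v :: "'a::euclidean_space"
  shows "strongly_convex (2 * c) (\<lambda>u. c * (norm (u - v))\<^sup>2)"
proof -
  have *: "(\<lambda>u. c * (norm (u - v))\<^sup>2 - 2 * c / 2 * (norm u)\<^sup>2)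
      = (\<lambda>u. c * (norm v)\<^sup>2 - 2 * c * (u \<bullet> v))"
    by (rule ext, unfold power2_norm_eq_inner) (simp add: inner_simps inner_commute algebra_simps)
  show ?thesis
    unfolding strongly_convex_def *
    by (rule convex_onI) (auto simp: inner_simps algebra_simps)
qed

lemma GDERIV_line:
  assumes "GDERIV h (x + s *\<^sub>R d) :> D"
  shows "((\<lambda>s. h (x + s *\<^sub>R d)) has_real_derivative (d \<bullet> D)) (at s)"
proof -
  have 1: "((\<lambda>s. x + s *\<^sub>R d) has_derivative (\<lambda>s. s *\<^sub>R d)) (at s)"
    by (auto intro!: derivative_eq_intros)
  have "((\<lambda>s. h (x + s *\<^sub>R d)) has_derivative (\<lambda>s. (s *\<^sub>R d) \<bullet> D)) (at s)"
    using has_derivative_compose[OF 1 assms[unfolded gderiv_def]] .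
  moreover have "(\<lambda>s. (s *\<^sub>R d) \<bullet> D) = (*) (d \<bullet> D)" by (simp add: fun_eq_iff)
  ultimately show ?thesis unfolding has_field_derivative_def by simp
qed

lemma smooth_withD:
  assumes "smooth_with L h"
  shows "GDERIV h u :> grad h u" "norm (grad h u - grad h v) \<le> L * norm (u - v)"
  using assms unfolding smooth_with_def lipschitz_on_def dist_norm by auto

text \<open>The descent lemma: along the segment, \<open>k\<close> is \<open>h\<close> minus the
  nonconstant part of the claimed bound, and it decreases by Cauchy-Schwarz and the Lipschitz
  gradient.\<close>

lemma smooth_upper_bound:
  assumes "smooth_with L h"
  shows "h y \<le> h x + grad h x \<bullet> (y - x) + L / 2 * (norm (y - x))\<^sup>2"
proof -
  define d where "d = y - x"
  define k where "k s = h (x + s *\<^sub>R d) - s * (grad h x \<bullet> d) - L / 2 * s\<^sup>2 * (norm d)\<^sup>2" for s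
  have "k 1 \<le> k 0"
  proof (rule DERIV_nonpos_imp_nonincreasing[of 0 1 k])
    fix s :: real assume s: "0 \<le> s" "s \<le> 1"
    have line: "((\<lambda>s. h (x + s *\<^sub>R d)) has_real_derivative (d \<bullet> grad h (x + s *\<^sub>R d))) (at s)"
      by (rule GDERIV_line[OF smooth_withD(1)[OF assms]])
    have "(k has_real_derivative (d \<bullet> grad h (x + s *\<^sub>R d) - grad h x \<bullet> d - L * s * (norm d)\<^sup>2)) (at s)"
      unfolding k_def
      by (rule derivative_eq_intros line refl | simp)+
    moreover have "d \<bullet> grad h (x + s *\<^sub>R d) - grad h x \<bullet> d - L * s * (norm d)\<^sup>2 \<le> 0"
    proof -
      have "d \<bullet> grad h (x + s *\<^sub>R d) - grad h x \<bullet> d = (grad h (x + s *\<^sub>R d) - grad h x) \<bullet> d"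
        by (simp add: inner_simps inner_commute)
      also have "\<dots> \<le> norm (grad h (x + s *\<^sub>R d) - grad h x) * norm d"
        by (rule norm_cauchy_schwarz)
      also have "\<dots> \<le> (L * norm (s *\<^sub>R d)) * norm d"
        using smooth_withD(2)[OF assms, of "x + s *\<^sub>R d" x] by (intro mult_right_mono) auto
      finally show ?thesis using s by (simp add: power2_eq_square mult.assoc)
    qed
    ultimately show "\<exists>y. (k has_real_derivative y) (at s) \<and> y \<le> 0" by blast
  qed simp
  then show ?thesis by (simp add: k_def d_def)
qed

text \<open>The inner product with \<open>D\<close> is the limit of difference quotients in the
  direction \<open>u - x\<close>, each bounded through strong convexity on the segment.\<close>

lemma strongly_convex_lower_bound:
  assumes q: "strongly_convex m q" and g: "GDERIV q x :> D"
  shows "q x + D \<bullet> (u - x) + m / 2 * (norm (u - x))\<^sup>2 \<le> q u"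
proof -
  define d where "d = u - x"
  define c where "c = m / 2 * (norm d)\<^sup>2"
  have "((\<lambda>s. q (x + s *\<^sub>R d)) has_real_derivative (d \<bullet> D)) (at 0)"
    using GDERIV_line[of q x 0 d D] g by simp
  then have "((\<lambda>s. (q (x + s *\<^sub>R d) - q x) / s) \<longlongrightarrow> d \<bullet> D) (at 0)"
    unfolding has_field_derivative_iff by simp
  then have 1: "((\<lambda>s. (q (x + s *\<^sub>R d) - q x) / s) \<longlongrightarrow> d \<bullet> D) (at_right 0)"
    by (rule filterlim_mono) (auto simp: at_le)
  have 2: "((\<lambda>s. q u - q x - (1 - s) * c) \<longlongrightarrow> q u - q x - c) (at_right 0)"
    by (auto intro!: tendsto_eq_intros)
  have "d \<bullet> D \<le> q u - q x - c"
  proof (rule tendsto_le[OF _ 2 1])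
    have "(q (x + s *\<^sub>R d) - q x) / s \<le> q u - q x - (1 - s) * c" if s: "0 < s" "s < 1" for s
    proof -
      have "q (x + s *\<^sub>R d) = q ((1 - s) *\<^sub>R x + s *\<^sub>R u)" by (simp add: d_def algebra_simps)
      also have "\<dots> \<le> (1 - s) * q x + s * q u - m / 2 * s * (1 - s) * (norm (u - x))\<^sup>2"
        using strongly_convexD[OF q] s by simp
      finally have "q (x + s *\<^sub>R d) - q x \<le> s * (q u - q x - (1 - s) * c)"
        by (simp add: c_def d_def algebra_simps)
      then show ?thesis using s by (simp add: field_simps)
    qed
    then show "eventually (\<lambda>s. (q (x + s *\<^sub>R d) - q x) / s \<le> q u - q x - (1 - s) * c) (at_right 0)"
      unfolding eventually_at_right_field by (auto intro!: exI[of _ 1])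
  qed simp
  then show ?thesis by (simp add: c_def d_def inner_commute)
qed

lemma strong_convexity_le_smoothness:
  fixes q :: "'a::euclidean_space \<Rightarrow> real"
  assumes "strongly_convex m q" "smooth_with L q"
  shows "m \<le> L"
proof -
  obtain b :: 'a where b: "b \<in> Basis" using nonempty_Basis by blast
  have "q 0 + grad q 0 \<bullet> b + m / 2 \<le> q b"
    using strongly_convex_lower_bound[OF assms(1) smooth_withD(1)[OF assms(2)], of 0 b] b by simp
  moreover have "q b \<le> q 0 + grad q 0 \<bullet> b + L / 2"
    using smooth_upper_bound[OF assms(2), of b 0] b by simp
  ultimately show ?thesis by simp
qed

text \<open>Keeps the denominator \<open>2 - \<mu> * \<eta>\<close> of the averaging weight at least
  3/2.\<close>

lemma strong_convexity_step_size_le: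
  fixes q :: "'a::euclidean_space \<Rightarrow> real"
  assumes "strongly_convex m q" "smooth_with L q" and L: "0 < L" and \<eta>: "0 < \<eta>" "\<eta> \<le> 1 / (2 * L)"
  shows "m * \<eta> \<le> 1 / 2"
proof -
  have "m * \<eta> \<le> L * \<eta>"
    using strong_convexity_le_smoothness[OF assms(1,2)] \<eta> by simp
  also have "\<dots> \<le> 1 / 2" using \<eta> L by (simp add: field_simps)
  finally show ?thesis .
qed

text \<open>The mean value inequality for \<open>p - q\<close>. It carries a bound on the change of
  gradients over to a change of gaps, where additive constants cancel.\<close>

lemma diff_bound_of_grad_diff_bound:
  assumes p: "\<And>v. GDERIV p v :> P v" and q: "\<And>v. GDERIV q v :> Q v"
    and C: "\<And>v. norm (P v - Q v) \<le> C"
  shows "(p x - q x) - (p y - q y) \<le> C * norm (x - y)"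
proof -
  have "norm ((p x - q x) - (p y - q y)) \<le> C * norm (x - y)"
  proof (rule differentiable_bound[where S = UNIV and f' = "\<lambda>v h. h \<bullet> (P v - Q v)"])
    fix v show "((\<lambda>v. p v - q v) has_derivative (\<lambda>h. h \<bullet> (P v - Q v))) (at v within UNIV)"
      using has_derivative_diff[OF p[unfolded gderiv_def] q[unfolded gderiv_def], of v]
      by (simp add: inner_simps)
    show "onorm (\<lambda>h. h \<bullet> (P v - Q v)) \<le> C"
    proof (rule onorm_bound)
      show "0 \<le> C" using C[of v] norm_ge_zero order_trans by blast
      fix h show "norm (h \<bullet> (P v - Q v)) \<le> C * norm h"
        using Cauchy_Schwarz_ineq2[of h "P v - Q v"] mult_left_mono[OF C[of v], of "norm h"]
        by (simp add: mult.commute)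
    qed
  qed auto
  then show ?thesis by simp
qed

subsection \<open>The proximal step\<close>

text \<open>\<open>real_of_ereal\<close> sends \<infinity> to 0, so convexity is claimed on the
  effective domain, where it is convexity of the epigraph at the points
  \<open>(u, h u)\<close>.\<close>

lemma proper_closed_convex_real:
  assumes "proper_closed_convex h"
  shows "convex_on {u. h u \<noteq> \<infinity>} (\<lambda>u. real_of_ereal (h u))"
proof -
  let ?S = "{u. h u \<noteq> \<infinity>}" and ?R = "\<lambda>u. real_of_ereal (h u)"
  have fin: "h u = ereal (?R u)" if "u \<in> ?S" for u
    using that assms unfolding proper_closed_convex_def by (auto simp: ereal_real)
  have epi: "h (a *\<^sub>R u + b *\<^sub>R v) \<le> ereal (a * ?R u + b * ?R v)"
    if "u \<in> ?S" "v \<in> ?S" "0 \<le> a" "0 \<le> b" "a + b = 1" for u v a b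
  proof -
    have "convex {(u, a::real). h u \<le> ereal a}"
      using assms unfolding proper_closed_convex_def by simp
    then have "a *\<^sub>R (u, ?R u) + b *\<^sub>R (v, ?R v) \<in> {(u, a::real). h u \<le> ereal a}"
      by (rule convexD) (use that fin[OF that(1)] fin[OF that(2)] in auto)
    then show ?thesis by simp
  qed
  have conv: "convex ?S"
  proof (rule convexI)
    fix u v a b assume "u \<in> ?S" "v \<in> ?S" "(0::real) \<le> a" "0 \<le> b" "a + b = 1"
    from epi[OF this] show "a *\<^sub>R u + b *\<^sub>R v \<in> ?S" by auto
  qed
  show ?thesis
  proof (rule convex_onI[OF _ conv])
    fix s u v assume s: "(0::real) < s" "s < 1" and uv: "u \<in> ?S" "v \<in> ?S"
    have "(1 - s) *\<^sub>R u + s *\<^sub>R v \<in> ?S" using convexD_alt[OF conv uv, of s] s by simp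
    from fin[OF this] epi[OF uv, of "1 - s" s] s
    show "?R ((1 - s) *\<^sub>R u + s *\<^sub>R v) \<le> (1 - s) * ?R u + s * ?R v"
      by (metis add.commute diff_add_cancel diff_ge_0_iff_ge ereal_less_eq(3) less_imp_le)
  qed
qed

text \<open>\<open>prox\<close> is a choice operator, so a minimizer has to be shown to exist.
  Closedness is that of the epigraph; accordingly the continuous function
  \<open>a + K * (norm (u - v))\<^sup>2\<close> of pairs \<open>(u, a)\<close> is minimized over a
  piece of the epigraph, which the quadratic minorant makes bounded.\<close>

lemma prox_is_arg_min:
  assumes h: "proper_closed_convex h" and \<eta>: "0 < \<eta>"
    and l: "0 < l" "l \<le> 1 / (2 * \<eta>)" and b: "0 \<le> b"
    and minorant: "\<And>u. ereal (C - b * norm (u - y) - l / 2 * (norm (u - y))\<^sup>2) \<le> h u"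
  shows "is_arg_min (\<lambda>u. h u + ereal (1 / (2 * \<eta>) * (norm (u - v))\<^sup>2)) (\<lambda>_. True) (prox \<eta> h v)"
proof -
  define K where "K = 1 / (2 * \<eta>)"
  have K: "0 < K" "l \<le> K" using \<eta> l by (auto simp: K_def)
  obtain u0 where u0: "h u0 \<noteq> \<infinity>" and ninf: "\<And>u. h u \<noteq> - \<infinity>"
    using h unfolding proper_closed_convex_def by auto
  define a0 where "a0 = real_of_ereal (h u0)"
  have a0: "h u0 = ereal a0" using u0 ninf[of u0] unfolding a0_def by (cases "h u0") auto
  define m where "m = a0 + K * (norm (u0 - v))\<^sup>2"
  \<comment> \<open>Cut off at the value of a feasible point \<open>u0\<close>: the set is nonempty,
    and any point beating the minimum found on it would lie in it.\<close>
  define T where "T = {(u, a::real). h u \<le> ereal a} \<inter> {p. snd p + K * (norm (fst p - v))\<^sup>2 \<le> m}"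
  define B where "B = b + 2 * K * norm (v - y)"
  \<comment> \<open>Radius from a quadratic inequality for \<open>n = norm (u - y)\<close>: for
    \<open>n > 1\<close> the constant term is at most that constant times \<open>n\<close>, and one
    factor \<open>n\<close> cancels.\<close>
  define r where "r = 1 + 2 / l * (B + \<bar>m - C\<bar>)"
  have B: "0 \<le> B" using b K by (simp add: B_def)
  have T_sub: "T \<subseteq> cball y r \<times> {C - b * r - l / 2 * r\<^sup>2..m}"
  proof
    fix p assume p: "p \<in> T"
    obtain u a where [simp]: "p = (u, a)" by force
    define n where "n = norm (u - y)"
    have "ereal (C - b * n - l / 2 * n\<^sup>2) \<le> ereal a"
      by (rule order_trans[OF minorant[of u, folded n_def]]) (use p in \<open>simp add: T_def\<close>)
    then have 1: "C - b * n - l / 2 * n\<^sup>2 \<le> a" by simp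
    have 2: "a + K * (norm (u - v))\<^sup>2 \<le> m" using p unfolding T_def by simp
    have "(norm (u - v))\<^sup>2 = n\<^sup>2 - 2 * ((u - y) \<bullet> (v - y)) + (norm (v - y))\<^sup>2"
      unfolding n_def power2_norm_eq_inner by (simp add: inner_simps inner_commute)
    moreover have "(u - y) \<bullet> (v - y) \<le> n * norm (v - y)"
      unfolding n_def by (rule norm_cauchy_schwarz)
    ultimately have "n\<^sup>2 - 2 * (n * norm (v - y)) \<le> (norm (u - v))\<^sup>2"
      using zero_le_power2[of "norm (v - y)"] by linarith
    then have "K * (n\<^sup>2 - 2 * (n * norm (v - y))) \<le> K * (norm (u - v))\<^sup>2"
      using K by (intro mult_left_mono) auto
    \<comment> \<open>As \<open>l \<le> K\<close>, at least \<open>l / 2\<close> of the proximal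
      curvature survives the loss of \<open>l / 2\<close> to the minorant.\<close>
    moreover have "l * n\<^sup>2 \<le> K * n\<^sup>2" using K by (intro mult_right_mono) auto
    ultimately have 3: "l / 2 * n\<^sup>2 \<le> B * n + \<bar>m - C\<bar>"
      using 1 2 abs_ge_self[of "m - C"] unfolding B_def by (simp add: algebra_simps)
    have n: "n \<le> r"
    proof (cases "n \<le> 1")
      case True
      then show ?thesis using B l by (simp add: r_def add_increasing2)
    next
      case False
      have "\<bar>m - C\<bar> \<le> \<bar>m - C\<bar> * n" using False by (simp add: mult_le_cancel_left1)
      with 3 have "l / 2 * n * n \<le> (B + \<bar>m - C\<bar>) * n"
        by (simp add: power2_eq_square algebra_simps)
      then have "l / 2 * n \<le> B + \<bar>m - C\<bar>" using False by simp
      then show ?thesis using l by (simp add: r_def field_simps)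
    qed
    have n0: "0 \<le> n" by (simp add: n_def)
    have "b * n \<le> b * r" "l / 2 * n\<^sup>2 \<le> l / 2 * r\<^sup>2"
      using n n0 b l by (auto intro!: mult_left_mono power_mono)
    then have "C - b * r - l / 2 * r\<^sup>2 \<le> a" using 1 by linarith
    moreover have "0 \<le> K * (norm (u - v))\<^sup>2" using K by simp
    then have "a \<le> m" using 2 by linarith
    ultimately show "p \<in> cball y r \<times> {C - b * r - l / 2 * r\<^sup>2..m}"
      using n by (simp add: n_def dist_norm norm_minus_commute)
  qed
  have "closed T"
    unfolding T_def using h unfolding proper_closed_convex_def
    by (intro closed_Int closed_Collect_le continuous_intros) auto
  moreover have "bounded T"
    by (rule bounded_subset[OF _ T_sub]) (intro bounded_Times bounded_cball bounded_closed_interval)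
  ultimately have comp: "compact T" by (simp add: compact_eq_bounded_closed)
  have T0: "(u0, a0) \<in> T" by (simp add: T_def a0 m_def)
  have ne: "T \<noteq> {}" using T0 by blast
  have "continuous_on T (\<lambda>p. snd p + K * (norm (fst p - v))\<^sup>2)"
    by (intro continuous_intros)
  from continuous_attains_inf[OF comp ne this] obtain q where q: "q \<in> T"
    "\<And>p. p \<in> T \<Longrightarrow> snd q + K * (norm (fst q - v))\<^sup>2 \<le> snd p + K * (norm (fst p - v))\<^sup>2"
    by blast
  have "is_arg_min (\<lambda>u. h u + ereal (K * (norm (u - v))\<^sup>2)) (\<lambda>_. True) (fst q)"
    unfolding is_arg_min_def
  proof (intro conjI notI TrueI, elim exE conjE)
    fix w assume less: "h w + ereal (K * (norm (w - v))\<^sup>2) < h (fst q) + ereal (K * (norm (fst q - v))\<^sup>2)"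
    have hq: "h (fst q) \<le> ereal (snd q)" using q(1) by (auto simp: T_def)
    then have le: "h (fst q) + ereal (K * (norm (fst q - v))\<^sup>2) \<le> ereal (snd q + K * (norm (fst q - v))\<^sup>2)"
      by (metis add_right_mono plus_ereal.simps(1))
    then have "h w + ereal (K * (norm (w - v))\<^sup>2) < ereal (snd q + K * (norm (fst q - v))\<^sup>2)"
      using less by order
    moreover from this have "h w \<noteq> \<infinity>" by auto
    then obtain c where c: "h w = ereal c" using ninf[of w] by (cases "h w") auto
    ultimately have lt: "c + K * (norm (w - v))\<^sup>2 < snd q + K * (norm (fst q - v))\<^sup>2" by simp
    moreover have "snd q + K * (norm (fst q - v))\<^sup>2 \<le> m" using q(1) by (auto simp: T_def)
    ultimately have "(w, c) \<in> T" by (simp add: T_def c)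
    from q(2)[OF this] lt show False by simp
  qed
  then show ?thesis unfolding prox_def arg_min_def K_def[symmetric] by (rule someI)
qed

text \<open>Adds three inequalities: quadratic growth of the proximal objective at
  \<open>xp\<close>, the descent lemma between \<open>x\<close> and \<open>xp\<close>, and strong
  convexity between \<open>x\<close> and \<open>u\<close>. The bias \<open>e\<close> is the part of
  the gradient error that is not noise; its share proportional to \<open>norm (x - u)\<close> is
  what reduces \<mu> to \<open>\<mu> - 2 * \<gamma>\<close>.\<close>

lemma prox_gradient_step:
  fixes \<phi> R :: "'a::euclidean_space \<Rightarrow> real" and \<mu> \<gamma> \<eta> :: real
  defines "\<rho> \<equiv> (\<mu> - 2 * \<gamma>) * \<eta> / (2 - \<mu> * \<eta>)"
  assumes smooth: "smooth_with L \<phi>" and sc: "strongly_convex \<mu> \<phi>" and R: "convex_on S R"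
    and u: "u \<in> S" and xp: "xp \<in> S"
    and min: "\<And>v. v \<in> S \<Longrightarrow>
        R xp + 1 / (2 * \<eta>) * (norm (xp - (x - \<eta> *\<^sub>R g)))\<^sup>2
          \<le> R v + 1 / (2 * \<eta>) * (norm (v - (x - \<eta> *\<^sub>R g)))\<^sup>2"
    and grad: "grad \<phi> x = g + e + z" and e: "norm e \<le> \<gamma> * norm (x - u) + G"
    and \<gamma>: "0 \<le> \<gamma>" "\<gamma> < \<mu> / 2" and L: "0 < L" and \<eta>: "0 < \<eta>" "\<eta> \<le> 1 / (2 * L)"
  shows "\<phi> xp + R xp - (\<phi> u + R u) \<le>
     z \<bullet> (x - u) + \<eta> * (norm z)\<^sup>2 + G\<^sup>2 / (\<mu> - 2 * \<gamma>)
     + (2 - \<mu> * \<eta>) / (4 * \<eta>) * ((1 - \<rho>) * (norm (x - u))\<^sup>2 - (norm (xp - u))\<^sup>2)"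
proof -
  define a b d where "a = norm (x - u)" and "b = norm (xp - u)" and "d = norm (xp - x)"
  have expand: "1 / (2 * \<eta>) * (norm (v - (x - \<eta> *\<^sub>R g)))\<^sup>2
      = (norm (v - x))\<^sup>2 / (2 * \<eta>) + g \<bullet> (v - x) + \<eta> * (norm g)\<^sup>2 / 2" for v
  proof -
    have "v - (x - \<eta> *\<^sub>R g) = (v - x) + \<eta> *\<^sub>R g" by simp
    then have "(norm (v - (x - \<eta> *\<^sub>R g)))\<^sup>2 = (norm (v - x))\<^sup>2 + 2 * \<eta> * (g \<bullet> (v - x)) + \<eta>\<^sup>2 * (norm g)\<^sup>2"
      unfolding power2_norm_eq_inner
      by (simp only: inner_add_left inner_add_right inner_scaleR_left inner_scaleR_right
          inner_commute[of "v - x" g] power2_eq_square) (simp add: algebra_simps)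
    then show ?thesis using \<eta> by (simp add: field_simps power2_eq_square)
  qed
  have "1 / (2 * \<eta>) * (norm (xp - (x - \<eta> *\<^sub>R g)))\<^sup>2 + R xp + 2 * (1 / (2 * \<eta>)) / 2 * (norm (u - xp))\<^sup>2
      \<le> 1 / (2 * \<eta>) * (norm (u - (x - \<eta> *\<^sub>R g)))\<^sup>2 + R u"
    using min by (intro quadratic_growth[OF strongly_convex_dist_sq R xp u]) (simp add: add.commute)
  then have 1: "R xp + g \<bullet> (xp - x) + d\<^sup>2 / (2 * \<eta>) + b\<^sup>2 / (2 * \<eta>) \<le> R u + g \<bullet> (u - x) + a\<^sup>2 / (2 * \<eta>)"
    unfolding expand a_def b_def d_def by (simp add: norm_minus_commute)
  have 2: "\<phi> xp \<le> \<phi> x + (g + e + z) \<bullet> (xp - x) + L / 2 * d\<^sup>2"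
    using smooth_upper_bound[OF smooth, of xp x] unfolding d_def grad .
  have 3: "\<phi> x + (g + e + z) \<bullet> (u - x) + \<mu> / 2 * a\<^sup>2 \<le> \<phi> u"
    using strongly_convex_lower_bound[OF sc smooth_withD(1)[OF smooth], of x u]
    unfolding a_def grad by (simp add: norm_minus_commute)
  \<comment> \<open>Half of the proximal term \<open>d\<^sup>2 / (2 * \<eta>)\<close> pays for the
    curvature of \<open>\<phi>\<close>; the other half is reserved for the noise.\<close>
  have "L / 2 \<le> 1 / (4 * \<eta>)" using L \<eta> by (simp add: field_simps)
  then have 4: "L / 2 * d\<^sup>2 \<le> 1 / (4 * \<eta>) * d\<^sup>2" by (rule mult_right_mono) simp
  have "z \<bullet> (xp - x) \<le> norm z * d" unfolding d_def by (rule norm_cauchy_schwarz)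
  moreover have "0 \<le> (2 * \<eta> * norm z - d)\<^sup>2 / (4 * \<eta>)" using \<eta> by simp
  then have "norm z * d \<le> \<eta> * (norm z)\<^sup>2 + 1 / (4 * \<eta>) * d\<^sup>2"
    using \<eta> by (simp add: field_simps power2_eq_square)
  ultimately have 5: "z \<bullet> (xp - x) \<le> \<eta> * (norm z)\<^sup>2 + 1 / (4 * \<eta>) * d\<^sup>2" by linarith
  have "e \<bullet> (xp - u) \<le> norm e * b" unfolding b_def by (rule norm_cauchy_schwarz)
  also have "\<dots> \<le> (\<gamma> * a + G) * b" using e by (intro mult_right_mono) (auto simp: a_def b_def)
  also have "\<dots> = \<gamma> * (a * b) + G * b" by (simp add: algebra_simps)
  also have "a * b \<le> (a\<^sup>2 + b\<^sup>2) / 2"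
    using zero_le_power2[of "a - b"] by (simp add: power2_eq_square algebra_simps)
  \<comment> \<open>Split so that the coefficients of \<open>b\<^sup>2\<close> add up to
    \<open>\<gamma> / 2 + (\<mu> - 2 * \<gamma>) / 4 = \<mu> / 4\<close>.\<close>
  also have "G * b \<le> G\<^sup>2 / (\<mu> - 2 * \<gamma>) + (\<mu> - 2 * \<gamma>) / 4 * b\<^sup>2"
  proof -
    have "0 \<le> (2 * G - (\<mu> - 2 * \<gamma>) * b)\<^sup>2 / (4 * (\<mu> - 2 * \<gamma>))" using \<gamma> by simp
    also have "\<dots> = G\<^sup>2 / (\<mu> - 2 * \<gamma>) + (\<mu> - 2 * \<gamma>) / 4 * b\<^sup>2 - G * b"
      using \<gamma> by (simp add: field_simps power2_eq_square)
    finally show ?thesis by simp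
  qed
  finally have "e \<bullet> (xp - u)
      \<le> \<gamma> * ((a\<^sup>2 + b\<^sup>2) / 2) + (G\<^sup>2 / (\<mu> - 2 * \<gamma>) + (\<mu> - 2 * \<gamma>) / 4 * b\<^sup>2)"
    using \<gamma> by (simp add: mult_left_mono)
  then have 6: "e \<bullet> (xp - u) \<le> \<gamma> / 2 * a\<^sup>2 + G\<^sup>2 / (\<mu> - 2 * \<gamma>) + \<mu> / 4 * b\<^sup>2"
    by (simp add: algebra_simps add_divide_distrib diff_divide_distrib)
  have "\<mu> * \<eta> \<le> 1 / 2"
    by (rule strong_convexity_step_size_le[OF sc smooth L \<eta>])
  then have "2 - \<mu> * \<eta> > 0" by simp
  \<comment> \<open>Origin of the averaging weight: it is the \<rho> for which the distance terms of
    the bounds collected so far contract by exactly \<open>1 - \<rho>\<close>.\<close>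
  then have 7: "(2 - \<mu> * \<eta>) / (4 * \<eta>) * ((1 - \<rho>) * a\<^sup>2 - b\<^sup>2)
     = a\<^sup>2 / (2 * \<eta>) - \<mu> / 2 * a\<^sup>2 + \<gamma> / 2 * a\<^sup>2 - b\<^sup>2 / (2 * \<eta>) + \<mu> / 4 * b\<^sup>2"
    unfolding \<rho>_def using \<eta> by (simp add: field_simps) 
  have 8: "d\<^sup>2 / (2 * \<eta>) = 1 / (4 * \<eta>) * d\<^sup>2 + 1 / (4 * \<eta>) * d\<^sup>2" using \<eta> by (simp add: field_simps)
  have 9: "(g + e + z) \<bullet> (xp - x) - (g + e + z) \<bullet> (u - x)
      = g \<bullet> (xp - x) - g \<bullet> (u - x) + e \<bullet> (xp - u) + z \<bullet> (xp - x) + z \<bullet> (x - u)"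
    by (simp add: inner_diff_right inner_add_left)
  show ?thesis
    using 1 2 3 4 5 6 8 9 unfolding a_def[symmetric] b_def[symmetric] 7 by linarith
qed

text \<open>The recursion starts from a gap for the objective at time \<open>t\<close>, while the
  estimate is stated with the gap at time 0. Adding the growth bounds of both minimizers gives
  \<open>(\<mu> - \<gamma>) * n \<le> G\<close>, so the two gradients differ by at most
  \<open>2 * G\<close>; the resulting term, linear in the distance to \<open>u'\<close>, is absorbed
  by quadratic growth.\<close>

lemma initial_gap_comparison:
  fixes \<phi> \<phi>' R :: "'a::euclidean_space \<Rightarrow> real"
  assumes smooth: "smooth_with L \<phi>" "smooth_with L \<phi>'"
    and sc: "strongly_convex \<mu> \<phi>" "strongly_convex \<mu> \<phi>'"
    and R: "convex_on S R" and mem: "u \<in> S" "u' \<in> S" "x \<in> S"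
    and u: "\<And>v. v \<in> S \<Longrightarrow> \<phi> u + R u \<le> \<phi> v + R v"
    and u': "\<And>v. v \<in> S \<Longrightarrow> \<phi>' u' + R u' \<le> \<phi>' v + R v"
    and drift: "\<And>v. norm (grad \<phi>' v - grad \<phi> v) \<le> \<gamma> * norm (u - u') + G"
    and \<gamma>: "0 \<le> \<gamma>" "\<gamma> < \<mu> / 2" and G: "0 \<le> G"
  shows "\<phi>' x + R x - (\<phi>' u' + R u') \<le> 2 * (\<phi> x + R x - (\<phi> u + R u)) + 8 * G\<^sup>2 / \<mu>"
proof -
  define n b where "n = norm (u - u')" and "b = norm (x - u')"
  note diff = diff_bound_of_grad_diff_bound[OF smooth_withD(1)[OF smooth(2)]
      smooth_withD(1)[OF smooth(1)] drift, folded n_def]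
  have 1: "\<phi> u + R u + \<mu> / 2 * n\<^sup>2 \<le> \<phi> u' + R u'"
    using quadratic_growth[OF sc(1) R mem(1,2) u] by (simp add: n_def norm_minus_commute)
  have 2: "\<phi>' u' + R u' + \<mu> / 2 * n\<^sup>2 \<le> \<phi>' u + R u"
    using quadratic_growth[OF sc(2) R mem(2,1) u'] by (simp add: n_def)
  have 3: "\<phi>' u - \<phi> u - (\<phi>' u' - \<phi> u') \<le> (\<gamma> * n + G) * n"
    using diff[of u u'] by (simp add: n_def)
  have "(\<mu> - \<gamma>) * n * n \<le> G * n"
    using 1 2 3 by (simp add: algebra_simps power2_eq_square)
  then have "(\<mu> - \<gamma>) * n \<le> G"
    using G by (cases "n = 0") (auto simp: n_def)
  \<comment> \<open>The gradient change caused by the moved equilibrium is thus at most the temporal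
    drift \<open>G\<close>.\<close>
  moreover have "\<gamma> * n \<le> (\<mu> - \<gamma>) * n" using \<gamma> by (intro mult_right_mono) (auto simp: n_def)
  ultimately have "\<gamma> * n + G \<le> 2 * G" by linarith
  then have "(\<gamma> * n + G) * b \<le> 2 * G * b" by (rule mult_right_mono) (simp add: b_def)
  then have 4: "\<phi>' x - \<phi> x - (\<phi>' u' - \<phi> u') \<le> 2 * G * b"
    using diff[of x u'] by (simp add: b_def)
  have 5: "\<phi>' u' + R u' + \<mu> / 2 * b\<^sup>2 \<le> \<phi>' x + R x"
    using quadratic_growth[OF sc(2) R mem(2,3) u'] by (simp add: b_def)
  have mu: "0 < \<mu>" using \<gamma> by linarith
  define w q where "w = \<mu> * b\<^sup>2" and "q = G\<^sup>2 / \<mu>"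
  \<comment> \<open>Tuned to use only half of the growth term \<open>w / 2\<close>; solving for the
    new gap then gives the factors 2 and 8.\<close>
  have "0 \<le> (\<mu> * b - 4 * G)\<^sup>2 / (4 * \<mu>)" using mu by simp
  also have "\<dots> = w / 4 + 4 * q - 2 * G * b"
    using mu by (simp add: w_def q_def field_simps power2_eq_square)
  finally have 6: "2 * G * b \<le> w / 4 + 4 * q" by simp
  have 7: "0 \<le> \<mu> / 2 * n\<^sup>2" using mu by simp
  have 8: "\<mu> / 2 * b\<^sup>2 = w / 2" "8 * G\<^sup>2 / \<mu> = 8 * q" by (simp_all add: w_def q_def)
  have combine: "E \<le> 2 * d + 8 * q"
    if "E \<le> d + c" "w / 2 \<le> E" "c \<le> w / 4 + 4 * q" for E d c q w :: real
    using that by linarith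
  have "\<phi>' x + R x - (\<phi>' u' + R u') \<le> \<phi> x + R x - (\<phi> u + R u) + 2 * G * b"
    using 1 4 7 by linarith
  from combine[OF this _ 6] 5 show ?thesis unfolding 8 by simp
qed

subsection \<open>Averaging\<close>

text \<open>The weights \<open>\<alpha> k = 2 * \<kappa> ^ k - \<kappa> ^ (2 * k)\<close> satisfy
  \<open>\<kappa> * \<alpha> k = \<alpha> (Suc k) - (1 - \<kappa>) * \<kappa> ^ (2 * k + 1)\<close>,
  and this defect is the negative multiple of \<open>V i\<close>. The exponent
  \<open>t - 1 - i\<close> counts the steps remaining after step \<open>i\<close>.\<close>

lemma averaged_recursion:
  fixes V N :: "nat \<Rightarrow> real"
  assumes \<kappa>: "0 \<le> \<kappa>" "\<kappa> \<le> 1"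
    and step: "\<And>i. i < t \<Longrightarrow> V (Suc i) \<le> \<kappa> * V i + (1 - \<kappa>) * N i"
  shows "V t \<le> (2 - \<kappa> ^ t) * \<kappa> ^ t * V 0 +
    (\<Sum>i<t. (1 - \<kappa>) * ((2 - \<kappa> ^ (t - 1 - i)) * \<kappa> ^ (t - 1 - i)) * N i
       - (1 - \<kappa>) * \<kappa> ^ (2 * (t - 1 - i) + 1) * V i)"
proof -
  define \<alpha> where "\<alpha> k = (2 - \<kappa> ^ k) * \<kappa> ^ k" for k
  define T where "T i = (1 - \<kappa>) * \<alpha> (t - 1 - i) * N i - (1 - \<kappa>) * \<kappa> ^ (2 * (t - 1 - i) + 1) * V i" for i
  have "\<alpha> (t - j) * V j \<le> \<alpha> t * V 0 + (\<Sum>i<j. T i)" if "j \<le> t" for j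
    using that
  proof (induction j)
    case (Suc j)
    define k where "k = t - 1 - j"
    have k: "t - j = Suc k" "t - Suc j = k" using Suc.prems by (auto simp: k_def)
    have "\<kappa> ^ k \<le> 1" using \<kappa> by (simp add: power_le_one)
    then have "0 \<le> \<alpha> k" using \<kappa> by (simp add: \<alpha>_def)
    then have "\<alpha> k * V (Suc j) \<le> \<alpha> k * (\<kappa> * V j + (1 - \<kappa>) * N j)"
      using step[of j] Suc.prems by (intro mult_left_mono) auto
    also have "\<dots> = \<alpha> (Suc k) * V j + T j"
      unfolding T_def \<alpha>_def k_def[symmetric] by (simp add: power_mult power2_eq_square algebra_simps)
    also have "\<alpha> (Suc k) * V j \<le> \<alpha> t * V 0 + (\<Sum>i<j. T i)" using Suc k by simp
    finally show ?case by (simp add: k)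
  qed simp
  from this[of t] show ?thesis by (simp add: \<alpha>_def T_def)
qed

section \<open>Geometric weights: sums, decay and the size of \<rho>\<close>

lemma sum_geometric_weights_le:
  fixes \<kappa> :: real
  assumes "0 \<le> \<kappa>"
  shows "(\<Sum>i<n. (1 - \<kappa>) * \<kappa> ^ i) \<le> 1"
proof -
  have "(\<Sum>i<n. (1 - \<kappa>) * \<kappa> ^ i) = 1 - \<kappa> ^ n"
    by (induction n) (auto simp: algebra_simps)
  then show ?thesis using assms by simp
qed

text \<open>A telescoping sum: the polynomial factor of \<open>T\<close> is the quadratic solution
  \<open>q\<close> of \<open>q i - \<kappa> * q (i + 1) = \<rho> * (i + 1)\<^sup>2\<close>. The sum
  is a truncated second moment of a geometric variable, whose full value is
  \<open>T 0 = (2 - \<rho>) / \<rho>\<^sup>2\<close>.\<close>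

lemma sum_quadratic_geometric_weights_le:
  fixes \<kappa> :: real
  assumes "0 \<le> \<kappa>" "\<kappa> < 1"
  shows "(\<Sum>i<n. (1 - \<kappa>) * \<kappa> ^ i * (real i + 1)\<^sup>2) \<le> 2 / (1 - \<kappa>)\<^sup>2"
proof -
  define \<rho> where "\<rho> = 1 - \<kappa>"
  have \<rho>: "0 < \<rho>" "\<rho> \<le> 1" "\<kappa> = 1 - \<rho>" using assms by (auto simp: \<rho>_def)
  define T where "T k = \<kappa> ^ k * ((real k)\<^sup>2 + 2 / \<rho> * real k + (2 / \<rho>\<^sup>2 - 1 / \<rho>))" for k
  have diff: "\<rho> * \<kappa> ^ i * (real i + 1)\<^sup>2 = T i - T (Suc i)" for i
  proof -
    define A B where "A = (real i)\<^sup>2 + 2 / \<rho> * real i + (2 / \<rho>\<^sup>2 - 1 / \<rho>)"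
      and "B = (real i + 1)\<^sup>2 + 2 / \<rho> * (real i + 1) + (2 / \<rho>\<^sup>2 - 1 / \<rho>)"
    have "\<rho> * (real i + 1)\<^sup>2 = A - \<kappa> * B"
      unfolding \<rho>(3) A_def B_def using \<rho>(1) by (simp add: field_simps power2_eq_square)
    then have "\<kappa> ^ i * (\<rho> * (real i + 1)\<^sup>2) = \<kappa> ^ i * (A - \<kappa> * B)" by simp
    also have "\<dots> = T i - T (Suc i)"
      unfolding T_def A_def B_def by (simp add: algebra_simps)
    finally have "\<kappa> ^ i * (\<rho> * (real i + 1)\<^sup>2) = T i - T (Suc i)" .
    then show ?thesis by (simp add: mult_ac)
  qed
  have "(\<Sum>i<n. \<rho> * \<kappa> ^ i * (real i + 1)\<^sup>2) = T 0 - T n"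
    unfolding diff by (rule sum_lessThan_telescope')
  also have "0 \<le> 2 / \<rho>\<^sup>2 - 1 / \<rho>" using \<rho> by (simp add: field_simps power2_eq_square)
  then have "0 \<le> T n" using assms \<rho> by (simp add: T_def)
  then have "T 0 - T n \<le> T 0" by simp
  also have "T 0 \<le> 2 / \<rho>\<^sup>2" using \<rho> by (simp add: T_def)
  finally show ?thesis by (simp add: \<rho>_def)
qed

text \<open>Combines \<open>\<kappa> ^ n \<le> exp (- y)\<close> with
  \<open>y\<^sup>2 \<le> 2 * exp y\<close>. It controls the squared drift since time 0, which is
  quadratic in \<open>t\<close> but damped by \<open>(1 - \<rho>) ^ t\<close>.\<close>

lemma power_times_square_le:
  fixes \<kappa> :: real
  assumes "0 \<le> \<kappa>" "\<kappa> < 1"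
  shows "\<kappa> ^ n * (real n)\<^sup>2 \<le> 2 / (1 - \<kappa>)\<^sup>2"
proof -
  define y where "y = real n * (1 - \<kappa>)"
  have "\<kappa> \<le> exp (- (1 - \<kappa>))" using exp_ge_add_one_self[of "- (1 - \<kappa>)"] by simp
  then have "\<kappa> ^ n \<le> exp (- (1 - \<kappa>)) ^ n" using assms by (intro power_mono) auto
  also have "\<dots> = exp (- y)" by (simp add: y_def exp_of_nat_mult[symmetric] algebra_simps)
  finally have "\<kappa> ^ n * y\<^sup>2 \<le> exp (- y) * y\<^sup>2" by (rule mult_right_mono) simp
  also have "\<dots> \<le> exp (- y) * (2 * exp y)"
  proof (intro mult_left_mono)
    have "0 \<le> y" using assms by (simp add: y_def)
    then show "y\<^sup>2 \<le> 2 * exp y" using exp_lower_Taylor_quadratic[of y] by linarith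
  qed simp
  also have "\<dots> = 2" by (simp add: exp_minus)
  finally show ?thesis using assms by (simp add: y_def power_mult_distrib pos_le_divide_eq)
qed

text \<open>The lower bound on \<rho> gives the rate of the theorem; the upper bounds let the
  distance term absorb the variance of the noise. The last identity fixes the coefficient of the
  squared distance in the potential.\<close>

lemma averaging_weight_bounds:
  fixes \<mu> \<gamma> \<eta> :: real
  defines "\<rho> \<equiv> (\<mu> - 2 * \<gamma>) * \<eta> / (2 - \<mu> * \<eta>)"
  assumes \<gamma>: "0 \<le> \<gamma>" "\<gamma> < \<mu> / 2" and \<eta>: "0 < \<eta>" "\<mu> * \<eta> \<le> 1 / 2"
  shows "0 < \<rho>" "(\<mu> - 2 * \<gamma>) * \<eta> / 2 \<le> \<rho>" "\<rho> \<le> 2 / 3 * ((\<mu> - 2 * \<gamma>) * \<eta>)" "\<rho> \<le> 1 / 3"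
    "\<rho> * ((2 - \<mu> * \<eta>) / (4 * \<eta>)) = (\<mu> - 2 * \<gamma>) / 4"
proof -
  let ?m = "(\<mu> - 2 * \<gamma>) * \<eta>"
  have m: "0 < ?m" using \<gamma> \<eta> by simp
  have d: "3 / 2 \<le> 2 - \<mu> * \<eta>" "2 - \<mu> * \<eta> \<le> 2" using \<eta> \<gamma> by simp_all
  show "0 < \<rho>" unfolding \<rho>_def using m d by (intro divide_pos_pos) linarith+
  show "?m / 2 \<le> \<rho>" unfolding \<rho>_def using m d by (intro divide_left_mono mult_pos_pos; linarith)
  have "\<rho> \<le> ?m / (3 / 2)" unfolding \<rho>_def using m d by (intro divide_left_mono mult_pos_pos; linarith)
  then show 1: "\<rho> \<le> 2 / 3 * ?m" by simp
  have "?m \<le> \<mu> * \<eta>" using \<gamma> \<eta> by (intro mult_right_mono) auto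
  then show "\<rho> \<le> 1 / 3" using 1 \<eta> by linarith
  have cancel: "M * \<eta> / y * (y / (4 * \<eta>)) = M / 4" if "y \<noteq> 0" for M y
    using that \<eta> by simp
  show "\<rho> * ((2 - \<mu> * \<eta>) / (4 * \<eta>)) = (\<mu> - 2 * \<gamma>) / 4"
    unfolding \<rho>_def using d \<eta> by (intro cancel) auto
qed

text \<open>All randomness is frozen here: \<open>z\<close> and \<open>G\<close> are arbitrary
  sequences, and the target \<open>u\<close> is the same at every step, which allows the bounds of
  the single steps to be chained.\<close>

lemma averaged_gap_bound:
  fixes \<phi> R :: "'a::euclidean_space \<Rightarrow> real" and x xh z g :: "nat \<Rightarrow> 'a"
    and \<mu> \<gamma> \<eta> :: real and t :: nat
  defines "\<rho> \<equiv> (\<mu> - 2 * \<gamma>) * \<eta> / (2 - \<mu> * \<eta>)"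
  defines "w \<equiv> \<lambda>i. (2 - (1 - \<rho>) ^ (t - 1 - i)) * (1 - \<rho>) ^ (t - 1 - i)"
  assumes smooth: "smooth_with L \<phi>" and sc: "strongly_convex \<mu> \<phi>" and R: "convex_on S R"
    and u: "u \<in> S" "\<And>v. v \<in> S \<Longrightarrow> \<phi> u + R u \<le> \<phi> v + R v"
    and x: "\<And>i. i \<le> t \<Longrightarrow> x i \<in> S"
    and min: "\<And>i v. i < t \<Longrightarrow> v \<in> S \<Longrightarrow>
        R (x (Suc i)) + 1 / (2 * \<eta>) * (norm (x (Suc i) - (x i - \<eta> *\<^sub>R g i)))\<^sup>2
          \<le> R v + 1 / (2 * \<eta>) * (norm (v - (x i - \<eta> *\<^sub>R g i)))\<^sup>2"
    and err: "\<And>i. i < t \<Longrightarrow> norm (grad \<phi> (x i) - g i - z i) \<le> \<gamma> * norm (x i - u) + G i"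
    and xh: "xh 0 = x 0" "\<And>i. i < t \<Longrightarrow> xh (Suc i) = (1 - \<rho>) *\<^sub>R xh i + \<rho> *\<^sub>R x (Suc i)"
    and \<gamma>: "0 \<le> \<gamma>" "\<gamma> < \<mu> / 2" and L: "0 < L" and \<eta>: "0 < \<eta>" "\<eta> \<le> 1 / (2 * L)"
  shows "xh t \<in> S"
    "\<phi> (xh t) + R (xh t) - (\<phi> u + R u) \<le> 3 * (1 - \<rho>) ^ t * (\<phi> (x 0) + R (x 0) - (\<phi> u + R u))
      + (\<Sum>i<t. \<rho> * w i * (z i \<bullet> (x i - u) + \<eta> * (norm (z i))\<^sup>2 + (G i)\<^sup>2 / (\<mu> - 2 * \<gamma>))
          - \<rho> * (1 - \<rho>) ^ (2 * (t - 1 - i) + 1) * ((\<mu> - 2 * \<gamma>) / 4 * (norm (x i - u))\<^sup>2))"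
proof -
  have "\<mu> * \<eta> \<le> 1 / 2"
    by (rule strong_convexity_step_size_le[OF sc smooth L \<eta>])
  note \<rho> = averaging_weight_bounds[OF \<gamma> \<eta>(1) this, folded \<rho>_def]
  define gap where "gap v = \<phi> v + R v - (\<phi> u + R u)" for v
  define D where "D i = (norm (x i - u))\<^sup>2" for i
  define m where "m = (\<mu> - 2 * \<gamma>) / 4"
  have m: "0 < m" using \<gamma> by (simp add: m_def)
  define N where "N i = z i \<bullet> (x i - u) + \<eta> * (norm (z i))\<^sup>2 + (G i)\<^sup>2 / (\<mu> - 2 * \<gamma>)" for i
  define V where "V i = gap (xh i) + m * D i" for i
  have S: "convex S" using R by (rule convex_on_imp_convex)
  have gap0: "0 \<le> gap v" if "v \<in> S" for v using u(2)[OF that] by (simp add: gap_def)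
  have gap_convex: "gap ((1 - \<rho>) *\<^sub>R v + \<rho> *\<^sub>R v') \<le> (1 - \<rho>) * gap v + \<rho> * gap v'"
    if "v \<in> S" "v' \<in> S" for v v'
  proof -
    have "0 \<le> \<mu> / 2 * \<rho> * (1 - \<rho>) * (norm (v' - v))\<^sup>2" using \<rho> \<gamma> by simp
    then have "\<phi> ((1 - \<rho>) *\<^sub>R v + \<rho> *\<^sub>R v') \<le> (1 - \<rho>) * \<phi> v + \<rho> * \<phi> v'"
      using strongly_convexD[OF sc, of \<rho> v v'] \<rho> by linarith
    moreover have "R ((1 - \<rho>) *\<^sub>R v + \<rho> *\<^sub>R v') \<le> (1 - \<rho>) * R v + \<rho> * R v'"
      using convex_onD[OF R _ _ that, of \<rho>] \<rho> by simp
    ultimately show ?thesis by (simp add: gap_def algebra_simps)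
  qed
  have xhS: "xh i \<in> S" if "i \<le> t" for i
    using that
  proof (induction i)
    case (Suc i)
    then show ?case
      using xh(2)[of i] convexD_alt[OF S _ x[of "Suc i"], of "xh i" \<rho>] \<rho> by simp
  qed (use xh x in auto)
  from this[of t] show "xh t \<in> S" by simp
  have step: "V (Suc i) \<le> (1 - \<rho>) * V i + (1 - (1 - \<rho>)) * N i" if i: "i < t" for i
  proof -
    have "gap (x (Suc i)) \<le> N i + (2 - \<mu> * \<eta>) / (4 * \<eta>) * ((1 - \<rho>) * D i - D (Suc i))"
      unfolding gap_def N_def D_def \<rho>_def
      by (rule prox_gradient_step[OF smooth sc R u(1) x min _ err \<gamma> L \<eta>]) (use i in auto)
    then have "\<rho> * gap (x (Suc i))
        \<le> \<rho> * (N i + (2 - \<mu> * \<eta>) / (4 * \<eta>) * ((1 - \<rho>) * D i - D (Suc i)))"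
      using \<rho> by (intro mult_left_mono) auto
    also have "\<dots> = \<rho> * N i + m * ((1 - \<rho>) * D i - D (Suc i))"
      unfolding distrib_left m_def \<rho>(5)[symmetric] by simp
    moreover have "gap (xh (Suc i)) \<le> (1 - \<rho>) * gap (xh i) + \<rho> * gap (x (Suc i))"
      unfolding xh(2)[OF i] by (rule gap_convex[OF xhS x]) (use i in auto)
    ultimately show ?thesis by (simp add: V_def algebra_simps)
  qed
  have "V t \<le> (2 - (1 - \<rho>) ^ t) * (1 - \<rho>) ^ t * V 0 +
    (\<Sum>i<t. \<rho> * w i * N i - \<rho> * (1 - \<rho>) ^ (2 * (t - 1 - i) + 1) * V i)"
    using averaged_recursion[of "1 - \<rho>" t V N, OF _ _ step] \<rho> by (simp add: w_def)
  \<comment> \<open>The factor 3 is 2 from the weights times 3/2 from quadratic growth, which bounds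
    the distance part of \<open>V 0\<close> by half the gap.\<close>
  also have "(2 - (1 - \<rho>) ^ t) * (1 - \<rho>) ^ t * V 0 \<le> 3 * (1 - \<rho>) ^ t * gap (x 0)"
  proof -
    have "\<phi> u + R u + \<mu> / 2 * D 0 \<le> \<phi> (x 0) + R (x 0)"
      unfolding D_def by (rule quadratic_growth[OF sc R u(1) x u(2)]) auto
    then have 1: "\<mu> / 2 * D 0 \<le> gap (x 0)" by (simp add: gap_def)
    have "m * D 0 \<le> \<mu> / 4 * D 0" unfolding m_def D_def using \<gamma> by (intro mult_right_mono) auto
    then have V0: "V 0 \<le> 3 / 2 * gap (x 0)" using 1 by (simp add: V_def xh)
    have "0 \<le> V 0" using gap0[OF xhS, of 0] m by (simp add: V_def D_def)
    then have "(2 - (1 - \<rho>) ^ t) * (1 - \<rho>) ^ t * V 0 \<le> 2 * (1 - \<rho>) ^ t * V 0"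
      using \<rho> by (intro mult_right_mono) auto
    also have "\<dots> \<le> 2 * (1 - \<rho>) ^ t * (3 / 2 * gap (x 0))"
      using V0 \<rho> by (intro mult_left_mono) auto
    finally show ?thesis by (simp add: mult_ac)
  qed
  \<comment> \<open>Of the negative terms only the distance part of \<open>V i\<close> is kept,
    because the variance to be absorbed is proportional to that squared distance.\<close>
  also have "(\<Sum>i<t. \<rho> * w i * N i - \<rho> * (1 - \<rho>) ^ (2 * (t - 1 - i) + 1) * V i)
     \<le> (\<Sum>i<t. \<rho> * w i * N i - \<rho> * (1 - \<rho>) ^ (2 * (t - 1 - i) + 1) * (m * D i))"
  proof (intro sum_mono diff_left_mono mult_left_mono)
    fix i assume "i \<in> {..<t}"
    then show "m * D i \<le> V i" using gap0[OF xhS, of i] by (simp add: V_def)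
  qed (use \<rho> in auto)
  finally have "V t \<le> 3 * (1 - \<rho>) ^ t * gap (x 0)
      + (\<Sum>i<t. \<rho> * w i * N i - \<rho> * (1 - \<rho>) ^ (2 * (t - 1 - i) + 1) * (m * D i))" by simp
  moreover have "gap (xh t) \<le> V t" using m by (simp add: V_def D_def)
  ultimately show "\<phi> (xh t) + R (xh t) - (\<phi> u + R u) \<le> 3 * (1 - \<rho>) ^ t * (\<phi> (x 0) + R (x 0) - (\<phi> u + R u))
      + (\<Sum>i<t. \<rho> * w i * (z i \<bullet> (x i - u) + \<eta> * (norm (z i))\<^sup>2 + (G i)\<^sup>2 / (\<mu> - 2 * \<gamma>))
          - \<rho> * (1 - \<rho>) ^ (2 * (t - 1 - i) + 1) * ((\<mu> - 2 * \<gamma>) / 4 * (norm (x i - u))\<^sup>2))"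
    by (simp add: gap_def N_def D_def m_def)
qed

section \<open>Extended-valued objectives and the bound for a single outcome\<close>

lemma equilibriumD:
  assumes eq: "equilibrium f r t y" and h: "proper_closed_convex (r t)"
  shows "r t y \<noteq> \<infinity>"
    "\<And>v. r t v \<noteq> \<infinity> \<Longrightarrow> f t y y + real_of_ereal (r t y) \<le> f t y v + real_of_ereal (r t v)"
proof -
  have le: "ereal (f t y y) + r t y \<le> ereal (f t y v) + r t v" for v
    using eq unfolding equilibrium_def is_arg_min_def by (metis linorder_not_less)
  obtain u0 where u0: "r t u0 \<noteq> \<infinity>" and ninf: "\<And>u. r t u \<noteq> - \<infinity>"
    using h unfolding proper_closed_convex_def by auto
  show fin: "r t y \<noteq> \<infinity>" using le[of u0] u0 ninf[of u0] by (cases "r t u0") auto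
  show "f t y y + real_of_ereal (r t y) \<le> f t y v + real_of_ereal (r t v)"
    if "r t v \<noteq> \<infinity>" for v
    using le[of v] fin that ninf[of v] ninf[of y] by (cases "r t y"; cases "r t v") auto
qed

lemma equilibrium_gap_eq:
  assumes h: "proper_closed_convex (r \<omega> t)" and "r \<omega> t (xbar t \<omega>) \<noteq> \<infinity>"
  shows "equilibrium_gap f r xbar y t \<omega> = (if r \<omega> t (y t \<omega>) = \<infinity> then \<infinity> else
    ereal (f \<omega> t (xbar t \<omega>) (y t \<omega>) + real_of_ereal (r \<omega> t (y t \<omega>))
      - (f \<omega> t (xbar t \<omega>) (xbar t \<omega>) + real_of_ereal (r \<omega> t (xbar t \<omega>)))))"
proof -
  have "r \<omega> t u \<noteq> - \<infinity>" for u using h unfolding proper_closed_convex_def by auto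
  from this[of "y t \<omega>"] this[of "xbar t \<omega>"] assms(2) show ?thesis
    unfolding equilibrium_gap_def equilibrium_objective_def
    by (cases "r \<omega> t (y t \<omega>)"; cases "r \<omega> t (xbar t \<omega>)") auto
qed

lemma equilibrium_gap_nonneg:
  assumes "equilibrium (f \<omega>) (r \<omega>) t (xbar t \<omega>)" "proper_closed_convex (r \<omega> t)"
  shows "0 \<le> equilibrium_gap f r xbar y t \<omega>"
  using equilibriumD[OF assms] 
  by (subst equilibrium_gap_eq[where r = r and t = t and \<omega> = \<omega> and xbar = xbar, OF assms(2)]) auto

text \<open>The equilibrium provides the lower bound on the regularizer that makes the proximal
  objective coercive, because the step size satisfies \<open>L \<le> 1 / (2 * \<eta>)\<close>.\<close>
lemma prox_minimizes:
  fixes \<phi> :: "'a::euclidean_space \<Rightarrow> real" and v :: 'a and \<eta> :: real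
  assumes h: "proper_closed_convex h" and smooth: "smooth_with L \<phi>"
    and u: "h u \<noteq> \<infinity>" "\<And>v. h v \<noteq> \<infinity> \<Longrightarrow> \<phi> u + real_of_ereal (h u) \<le> \<phi> v + real_of_ereal (h v)"
    and L: "0 < L" and \<eta>: "0 < \<eta>" "\<eta> \<le> 1 / (2 * L)"
  defines "p \<equiv> prox \<eta> h v"
  shows "h p \<noteq> \<infinity>"
    "\<And>q. h q \<noteq> \<infinity> \<Longrightarrow> real_of_ereal (h p) + 1 / (2 * \<eta>) * (norm (p - v))\<^sup>2
        \<le> real_of_ereal (h q) + 1 / (2 * \<eta>) * (norm (q - v))\<^sup>2"
proof -
  have ninf: "h q \<noteq> - \<infinity>" for q using h unfolding proper_closed_convex_def by auto
  have "is_arg_min (\<lambda>u. h u + ereal (1 / (2 * \<eta>) * (norm (u - v))\<^sup>2)) (\<lambda>_. True) p"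
    unfolding p_def
  proof (rule prox_is_arg_min[OF h \<eta>(1) L])
    show "L \<le> 1 / (2 * \<eta>)" using L \<eta> by (simp add: field_simps)
    show "0 \<le> norm (grad \<phi> u)" by simp
    fix q
    show "ereal (real_of_ereal (h u) - norm (grad \<phi> u) * norm (q - u) - L / 2 * (norm (q - u))\<^sup>2) \<le> h q"
    proof (cases "h q = \<infinity>")
      case False
      have "grad \<phi> u \<bullet> (q - u) \<le> norm (grad \<phi> u) * norm (q - u)" by (rule norm_cauchy_schwarz)
      then have "real_of_ereal (h u) - norm (grad \<phi> u) * norm (q - u) - L / 2 * (norm (q - u))\<^sup>2
          \<le> real_of_ereal (h q)"
        using u(2)[OF False] smooth_upper_bound[OF smooth, of q u] by linarith
      then show ?thesis using False ninf[of q] by (cases "h q") auto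
    qed simp
  qed
  then have le: "h p + ereal (1 / (2 * \<eta>) * (norm (p - v))\<^sup>2) \<le> h q + ereal (1 / (2 * \<eta>) * (norm (q - v))\<^sup>2)" for q
    unfolding is_arg_min_def by (metis linorder_not_less)
  show fin: "h p \<noteq> \<infinity>" using le[of u] u(1) ninf[of u] by (cases "h u") auto
  show "real_of_ereal (h p) + 1 / (2 * \<eta>) * (norm (p - v))\<^sup>2
        \<le> real_of_ereal (h q) + 1 / (2 * \<eta>) * (norm (q - v))\<^sup>2" if "h q \<noteq> \<infinity>" for q
    using le[of q] fin that ninf[of q] ninf[of p] by (cases "h p"; cases "h q") auto
qed

lemma gradient_sensitivityD:
  fixes f :: "'w \<Rightarrow> nat \<Rightarrow> 'a::euclidean_space \<Rightarrow> 'a \<Rightarrow> real"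
  assumes "ereal \<gamma> = gradient_sensitivity \<Omega> f" and \<omega>: "\<omega> \<in> \<Omega>"
  shows "norm (grad (f \<omega> t x) u - grad (f \<omega> t y) u) \<le> \<gamma> * norm (x - y)" "0 \<le> \<gamma>"
proof -
  have le: "norm (grad (f \<omega> t x) u - grad (f \<omega> t y) u) / norm (x - y) \<le> \<gamma>" if "x \<noteq> y" for t x y u
  proof -
    have "ereal (norm (grad (f \<omega> t x) u - grad (f \<omega> t y) u) / norm (x - y)) \<le> ereal \<gamma>"
      unfolding assms(1) gradient_sensitivity_def
      by (rule SUP_upper2[OF \<omega>], rule SUP_upper2[of t], simp, rule SUP_upper2[of u], simp,
          rule SUP_upper2[of x], simp, rule SUP_upper2[of y]) (use that in auto)
    then show ?thesis by simp
  qed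
  then show "norm (grad (f \<omega> t x) u - grad (f \<omega> t y) u) \<le> \<gamma> * norm (x - y)"
    by (cases "x = y") (auto simp: field_simps)
  \<comment> \<open>Nonnegativity of \<gamma> requires two distinct decisions; 0 and a basis vector
    serve.\<close>
  obtain b :: 'a where "b \<in> Basis" using nonempty_Basis by blast
  then have "b \<noteq> 0" by (rule nonzero_Basis)
  from le[OF this, of t u] show "0 \<le> \<gamma>" by (rule order_trans[rotated]) simp
qed

lemma gradient_driftD:
  assumes "gradient_drift f i t \<omega> \<noteq> \<infinity>"
  shows "norm (grad (f \<omega> i x) u - grad (f \<omega> t x) u) \<le> enn2real (gradient_drift f i t \<omega>)"
proof -
  have "ennreal (norm (grad (f \<omega> i x) u - grad (f \<omega> t x) u)) \<le> gradient_drift f i t \<omega>"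
    unfolding gradient_drift_def by (rule SUP_upper2[of u], simp, rule SUP_upper2[of x]) auto
  also have "\<dots> = ennreal (enn2real (gradient_drift f i t \<omega>))"
    using assms by (simp add: less_top)
  finally show ?thesis by (simp add: ennreal_le_iff)
qed

text \<open>Applies the deterministic bound to the algorithm with \<open>xbar t\<close> as fixed
  target. Against the gradient of the objective at time \<open>t\<close>, the error beyond the noise
  is a shift of the decision, at most \<gamma> times the distance of \<open>x i\<close> to the
  target, plus the temporal drift \<open>G i\<close>.\<close>

lemma pathwise_gap_bound:
  fixes f :: "'w \<Rightarrow> nat \<Rightarrow> 'a::euclidean_space \<Rightarrow> 'a \<Rightarrow> real" and \<mu> \<gamma> \<eta> :: real
  assumes psg: "averaged_decision_dependent_psg M F \<mu> L \<gamma> f r (\<lambda>_. \<eta>) x xhat xbar g"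
    and \<eta>: "0 < \<eta>" "\<eta> \<le> 1 / (2 * L)"
    and r_const: "\<And>s t. r \<omega> s = r \<omega> t" and \<omega>: "\<omega> \<in> space M" and t: "0 < t"
    and drift: "\<And>i. i < t \<Longrightarrow> gradient_drift f i t \<omega> \<noteq> \<infinity>"
    and d: "equilibrium_gap f r xbar x 0 \<omega> = ereal d"
  defines "\<rho> \<equiv> (\<mu> - 2 * \<gamma>) * \<eta> / (2 - \<mu> * \<eta>)"
  defines "w \<equiv> \<lambda>i. (2 - (1 - \<rho>) ^ (t - 1 - i)) * (1 - \<rho>) ^ (t - 1 - i)"
  defines "z \<equiv> \<lambda>i. gradient_noise f x g i \<omega>"
  defines "G \<equiv> \<lambda>i. enn2real (gradient_drift f i t \<omega>)"
  shows "equilibrium_gap f r xbar xhat t \<omega> \<le> ereal (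
      3 * (1 - \<rho>) ^ t * (2 * d + 8 * (G 0)\<^sup>2 / \<mu>)
      + (\<Sum>i<t. \<rho> * w i * (z i \<bullet> (x i \<omega> - xbar t \<omega>) + \<eta> * (norm (z i))\<^sup>2 + (G i)\<^sup>2 / (\<mu> - 2 * \<gamma>))
          - \<rho> * (1 - \<rho>) ^ (2 * (t - 1 - i) + 1) * ((\<mu> - 2 * \<gamma>) / 4 * (norm (x i \<omega> - xbar t \<omega>))\<^sup>2)))"
proof -
  interpret averaged_decision_dependent_psg M F \<mu> L \<gamma> f r "\<lambda>_. \<eta>" x xhat xbar g by (rule psg)
  define h where "h = r \<omega> t"
  have rh: "r \<omega> s = h" for s unfolding h_def by (rule r_const)
  define R where "R v = real_of_ereal (h v)" for v
  define S where "S = {v. h v \<noteq> \<infinity>}"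
  have h: "proper_closed_convex h" unfolding h_def by (rule regularizer[OF \<omega>])
  have R: "convex_on S R" using proper_closed_convex_real[OF h] by (simp add: S_def R_def[abs_def])
  define u where "u s = xbar s \<omega>" for s
  define \<phi> where "\<phi> s = f \<omega> s (u s)" for s
  have smooth: "smooth_with L (\<phi> s)" for s unfolding \<phi>_def by (rule loss_smooth[OF \<omega>])
  have sc: "strongly_convex \<mu> (\<phi> s)" for s unfolding \<phi>_def by (rule loss_strongly_convex[OF \<omega>])
  have uS: "u s \<in> S" and umin: "\<And>v. v \<in> S \<Longrightarrow> \<phi> s (u s) + R (u s) \<le> \<phi> s v + R v" for s
    using equilibriumD[OF xbar_equilibrium[OF \<omega>] regularizer[OF \<omega>], of s]
    by (auto simp: rh u_def \<phi>_def S_def R_def)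
  have gap: "equilibrium_gap f r xbar y s \<omega> =
      (if y s \<omega> \<notin> S then \<infinity> else ereal (\<phi> s (y s \<omega>) + R (y s \<omega>) - (\<phi> s (u s) + R (u s))))" for y s
    using equilibrium_gap_eq[of r \<omega> s xbar f y] h uS[of s]
    by (simp add: rh u_def \<phi>_def S_def R_def)
  have x0: "x 0 \<omega> \<in> S" and d_eq: "d = \<phi> 0 (x 0 \<omega>) + R (x 0 \<omega>) - (\<phi> 0 (u 0) + R (u 0))"
    using d unfolding gap by (auto split: if_splits)
  note \<gamma> = gradient_sensitivityD[OF gamma_eq \<omega>]
  \<comment> \<open>With a common regularizer every proximal step belongs to the problem at time
    \<open>t\<close>, whose equilibrium supplies the coercivity for all of them.\<close>
  note prox = prox_minimizes[OF h smooth[of t] _ _ L_pos \<eta>, where u = "u t", folded R_def]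
  have xSuc: "x (Suc i) \<omega> = prox \<eta> h (x i \<omega> - \<eta> *\<^sub>R g i \<omega>)" for i
    using x_Suc[OF \<omega>, of i] by (simp add: rh)
  have xS: "x i \<omega> \<in> S" for i
  proof (cases i)
    case (Suc j)
    then show ?thesis using prox(1) uS[of t] umin[of _ t] by (auto simp: xSuc S_def)
  qed (use x0 in simp)
  have xmin: "R (x (Suc i) \<omega>) + 1 / (2 * \<eta>) * (norm (x (Suc i) \<omega> - (x i \<omega> - \<eta> *\<^sub>R g i \<omega>)))\<^sup>2
          \<le> R v + 1 / (2 * \<eta>) * (norm (v - (x i \<omega> - \<eta> *\<^sub>R g i \<omega>)))\<^sup>2" if "v \<in> S" for i v
    unfolding xSuc using that uS[of t] umin[of _ t] by (intro prox(2)) (auto simp: S_def)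
  have err: "norm (grad (\<phi> t) (x i \<omega>) - g i \<omega> - z i) \<le> \<gamma> * norm (x i \<omega> - u t) + G i" if i: "i < t" for i
  proof -
    \<comment> \<open>The first bracket changes only the decision, the second only the time.\<close>
    have "grad (\<phi> t) (x i \<omega>) - g i \<omega> - z i
      = (grad (f \<omega> t (u t)) (x i \<omega>) - grad (f \<omega> t (x i \<omega>)) (x i \<omega>))
        - (grad (f \<omega> i (x i \<omega>)) (x i \<omega>) - grad (f \<omega> t (x i \<omega>)) (x i \<omega>))"
      by (simp add: z_def gradient_noise_def \<phi>_def)
    then show ?thesis
      using norm_triangle_ineq4[of "grad (f \<omega> t (u t)) (x i \<omega>) - grad (f \<omega> t (x i \<omega>)) (x i \<omega>)"
          "grad (f \<omega> i (x i \<omega>)) (x i \<omega>) - grad (f \<omega> t (x i \<omega>)) (x i \<omega>)"]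
        \<gamma>(1)[of t "u t" "x i \<omega>" "x i \<omega>"] gradient_driftD[OF drift[OF i], of "x i \<omega>" "x i \<omega>"]
      by (simp add: G_def norm_minus_commute)
  qed
  have xh: "xhat 0 \<omega> = x 0 \<omega>" "\<And>i. xhat (Suc i) \<omega> = (1 - \<rho>) *\<^sub>R xhat i \<omega> + \<rho> *\<^sub>R x (Suc i) \<omega>"
    using xhat_0[OF \<omega>] xhat_Suc[OF \<omega>] by (auto simp: \<rho>_def)
  note average = averaged_gap_bound[where \<phi> = "\<phi> t" and R = R and S = S and u = "u t"
      and x = "\<lambda>i. x i \<omega>" and xh = "\<lambda>i. xhat i \<omega>" and g = "\<lambda>i. g i \<omega>" and z = z and G = G
      and t = t and L = L and \<mu> = \<mu> and \<gamma> = \<gamma> and \<eta> = \<eta>, folded \<rho>_def]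
  have bound: "xhat t \<omega> \<in> S"
    "\<phi> t (xhat t \<omega>) + R (xhat t \<omega>) - (\<phi> t (u t) + R (u t))
      \<le> 3 * (1 - \<rho>) ^ t * (\<phi> t (x 0 \<omega>) + R (x 0 \<omega>) - (\<phi> t (u t) + R (u t)))
      + (\<Sum>i<t. \<rho> * w i * (z i \<bullet> (x i \<omega> - u t) + \<eta> * (norm (z i))\<^sup>2 + (G i)\<^sup>2 / (\<mu> - 2 * \<gamma>))
          - \<rho> * (1 - \<rho>) ^ (2 * (t - 1 - i) + 1) * ((\<mu> - 2 * \<gamma>) / 4 * (norm (x i \<omega> - u t))\<^sup>2))"
    unfolding w_def by (rule average;
        (rule smooth sc R uS umin xS xmin err xh \<gamma>(2) gamma_less L_pos \<eta>; assumption?))+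
  have init: "\<phi> t (x 0 \<omega>) + R (x 0 \<omega>) - (\<phi> t (u t) + R (u t)) \<le> 2 * d + 8 * (G 0)\<^sup>2 / \<mu>"
    unfolding d_eq
  proof (rule initial_gap_comparison[OF smooth smooth sc sc R uS uS x0 umin umin _ \<gamma>(2) gamma_less])
    fix v
    have "grad (\<phi> t) v - grad (\<phi> 0) v = (grad (f \<omega> t (u t)) v - grad (f \<omega> t (u 0)) v)
        - (grad (f \<omega> 0 (u 0)) v - grad (f \<omega> t (u 0)) v)" by (simp add: \<phi>_def)
    then show "norm (grad (\<phi> t) v - grad (\<phi> 0) v) \<le> \<gamma> * norm (u 0 - u t) + G 0"
      using norm_triangle_ineq4[of "grad (f \<omega> t (u t)) v - grad (f \<omega> t (u 0)) v"
          "grad (f \<omega> 0 (u 0)) v - grad (f \<omega> t (u 0)) v"]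
        \<gamma>(1)[of t "u t" v "u 0"] gradient_driftD[OF drift[OF t], of "u 0" v]
      by (simp add: G_def norm_minus_commute)
  qed (auto simp: G_def)
  have "\<mu> * \<eta> \<le> 1 / 2"
    by (rule strong_convexity_step_size_le[OF sc smooth L_pos \<eta>])
  note \<rho> = averaging_weight_bounds[OF \<gamma>(2) gamma_less \<eta>(1) this, folded \<rho>_def]
  have "3 * (1 - \<rho>) ^ t * (\<phi> t (x 0 \<omega>) + R (x 0 \<omega>) - (\<phi> t (u t) + R (u t)))
      \<le> 3 * (1 - \<rho>) ^ t * (2 * d + 8 * (G 0)\<^sup>2 / \<mu>)"
    using \<rho> init by (intro mult_left_mono) auto
  then show "equilibrium_gap f r xbar xhat t \<omega> \<le> ereal (
      3 * (1 - \<rho>) ^ t * (2 * d + 8 * (G 0)\<^sup>2 / \<mu>)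
      + (\<Sum>i<t. \<rho> * w i * (z i \<bullet> (x i \<omega> - xbar t \<omega>) + \<eta> * (norm (z i))\<^sup>2 + (G i)\<^sup>2 / (\<mu> - 2 * \<gamma>))
          - \<rho> * (1 - \<rho>) ^ (2 * (t - 1 - i) + 1) * ((\<mu> - 2 * \<gamma>) / 4 * (norm (x i \<omega> - xbar t \<omega>))\<^sup>2)))"
    unfolding gap using bound by (simp add: u_def)
qed

subsection \<open>Exponential moments\<close>

text \<open>For a centred variable this leaves only an exponential square moment, as the linear term
  has mean 0. For \<open>s \<le> 1\<close> the chain passes through
  \<open>1 + s + s\<^sup>2\<close>; for \<open>s > 1\<close> already
  \<open>s \<le> s\<^sup>2\<close>.\<close>

lemma exp_le_self_add_exp_sq: "exp s \<le> s + exp (s\<^sup>2)" for s :: real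
proof (cases "s \<le> 1")
  case True
  have 1: "1 + s\<^sup>2 \<le> exp (s\<^sup>2)" by (rule exp_ge_add_one_self)
  consider "0 \<le> s" | "-1 \<le> s" "s < 0" | "s < -1" by linarith
  then have "exp s \<le> 1 + s + s\<^sup>2"
  proof cases
    case 1
    then show ?thesis using exp_bound[of s] True by simp
  next
    case 2
    define a where "a = - s"
    have a: "0 \<le> a" using 2 by (simp add: a_def)
    \<comment> \<open>\<open>exp (- a) \<le> 1 - a + a\<^sup>2\<close> is verified by multiplying
      with a Taylor lower bound of \<open>exp a\<close>.\<close>
    have "1 * exp s \<le> ((1 - a + a\<^sup>2) * (1 + a + a\<^sup>2 / 2)) * exp s"
    proof (rule mult_right_mono)
      have "(1 - a + a\<^sup>2) * (1 + a + a\<^sup>2 / 2) = 1 + a\<^sup>2 / 2 + a ^ 3 / 2 + a ^ 4 / 2"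
        by (simp add: field_simps power2_eq_square power3_eq_cube power4_eq_xxxx)
      then show "1 \<le> (1 - a + a\<^sup>2) * (1 + a + a\<^sup>2 / 2)" using a by simp
    qed simp
    also have "\<dots> \<le> (1 - a + a\<^sup>2) * exp a * exp s"
    proof (intro mult_right_mono mult_left_mono)
      show "1 + a + a\<^sup>2 / 2 \<le> exp a" by (rule exp_lower_Taylor_quadratic[OF a])
      show "0 \<le> 1 - a + a\<^sup>2" using 2 by (simp add: a_def)
    qed simp
    also have "\<dots> = 1 - a + a\<^sup>2" by (simp add: a_def mult.assoc flip: exp_add)
    finally show ?thesis by (simp add: a_def)
  next
    case 3
    then have "- s \<le> s\<^sup>2" using mult_left_mono[of 1 "- s" "- s"] by (simp add: power2_eq_square)
    moreover have "exp s \<le> 1" using 3 by simp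
    ultimately show ?thesis by linarith
  qed
  then show ?thesis using 1 by linarith
next
  case False
  then have "s \<le> s\<^sup>2" by (simp add: power2_eq_square)
  then have "exp s \<le> exp (s\<^sup>2)" by simp
  then show ?thesis using False by linarith
qed

lemma exp_scaled_le:
  fixes x :: real
  assumes "0 \<le> \<theta>" "\<theta> \<le> 1"
  shows "exp (\<theta> * x) \<le> 1 - \<theta> + \<theta> * exp x"
  using convex_onD[OF exp_convex, of \<theta> 0 x] assms by simp

text \<open>The right-hand side is affine in \<open>s\<close> and \<open>exp q\<close>, so a conditional expectation can be
  applied to it with \<open>p\<close> as a parameter.\<close>
lemma exp_subgaussian_affine_bound:
  fixes p q s :: real
  assumes sq: "s\<^sup>2 \<le> p * q" and p: "0 \<le> p" and q: "0 \<le> q"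
  defines "\<theta> \<equiv> if p \<le> 1 then p else 1 / 2"
  shows "exp (s - 2 * p) \<le> (if p \<le> 1 then exp (- 2 * p) else 0) * s + (1 - \<theta>) + \<theta> * exp (q - 2)"
proof (cases "p \<le> 1")
  case True
  have "exp (s - 2 * p) = exp (- 2 * p) * exp s" by (simp flip: exp_add)
  also have "\<dots> \<le> exp (- 2 * p) * (s + exp (p * q))"
  proof (rule mult_left_mono)
    show "exp s \<le> s + exp (p * q)"
      using exp_le_self_add_exp_sq[of s] sq by (smt (verit) exp_le_cancel_iff)
  qed simp
  also have "\<dots> = exp (- 2 * p) * s + exp (p * (q - 2))"
    by (simp add: distrib_left algebra_simps flip: exp_add)
  also have "exp (p * (q - 2)) \<le> 1 - p + p * exp (q - 2)"
    using p True by (rule exp_scaled_le)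
  finally show ?thesis using True by (simp add: \<theta>_def)
next
  case False
  \<comment> \<open>For large \<open>p\<close> the compensation \<open>2 * p\<close> suffices
    without centring: \<open>s \<le> (p + q) / 2\<close> gives
    \<open>s - 2 * p \<le> (q - 2) / 2\<close>. The 2 in \<open>q - 2\<close> is matched to the
    bound \<open>exp 2\<close> on the moment of \<open>exp q\<close>.\<close>
  have "p * q \<le> ((p + q) / 2)\<^sup>2"
    using zero_le_power2[of "p - q"] by (simp add: power2_eq_square field_simps)
  then have "s\<^sup>2 \<le> ((p + q) / 2)\<^sup>2" using sq by linarith
  then have "s \<le> (p + q) / 2" by (rule power2_le_imp_le) (use p q in simp)
  then have "exp (s - 2 * p) \<le> exp (1 / 2 * (q - 2))" using False by simp
  also have "\<dots> \<le> 1 - 1 / 2 + 1 / 2 * exp (q - 2)" by (rule exp_scaled_le) auto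
  finally show ?thesis using False by (simp add: \<theta>_def)
qed

text \<open>A discrete layer-cake bound: with \<open>N\<close> the integer part of \<open>q\<close>,
  \<open>exp q\<close> is at most \<open>exp (N + 1)\<close>, which telescopes from
  \<open>exp 1\<close> through the layers \<open>m < N\<close>, all active at
  \<open>q\<close>.\<close>

lemma exp_le_layers:
  assumes q: "0 \<le> q"
  shows "ennreal (exp q) \<le> ennreal (exp 1) +
    (\<Sum>m. ennreal (exp (real m + 2) - exp (real m + 1)) * indicator {real m + 1..} q)"
proof -
  define N where "N = nat \<lfloor>q\<rfloor>"
  define c where "c m = exp (real m + 2) - exp (real m + 1)" for m
  have c: "0 \<le> c m" for m by (simp add: c_def)
  have N: "real N \<le> q" "q \<le> real N + 1" using q by (simp_all add: N_def)
  have "(\<Sum>m<N. c m) = exp (real N + 1) - exp 1"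
    by (induction N) (auto simp: c_def add_ac)
  then have "exp q \<le> exp 1 + (\<Sum>m<N. c m)" using N by simp
  then have "ennreal (exp q) \<le> ennreal (exp 1) + (\<Sum>m<N. ennreal (c m))"
    using c by (simp add: sum_nonneg flip: ennreal_plus)
  also have "(\<Sum>m<N. ennreal (c m)) = (\<Sum>m<N. ennreal (c m) * indicator {real m + 1..} q)"
    using N by (intro sum.cong) (auto simp: indicator_def)
  also have "\<dots> \<le> (\<Sum>m. ennreal (c m) * indicator {real m + 1..} q)"
    by (intro sum_le_suminf) auto
  finally show ?thesis by (simp add: c_def)
qed

text \<open>Summing over integer levels of \<open>(Z / \<sigma>)\<^sup>2\<close>, the tail
  \<open>2 * exp (- 2 * (m + 1))\<close> beats the increment of order \<open>exp (m + 1)\<close>;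
  relative to the integral of \<open>W\<close> the layers add up to 2, and
  \<open>exp 1 + 2 \<le> exp 2\<close>.\<close>

lemma (in prob_space) weighted_exp_square_moment:
  fixes W Z :: "'a \<Rightarrow> real"
  assumes W: "integrable M W" "\<And>\<omega>. 0 \<le> W \<omega>" and Z[measurable]: "Z \<in> borel_measurable M"
    and Z0: "\<And>\<omega>. 0 \<le> Z \<omega>" and \<sigma>: "0 < \<sigma>"
    and tail: "\<And>\<tau>. 0 < \<tau> \<Longrightarrow>
      (\<integral>\<omega>. W \<omega> * indicator {\<omega>\<in>space M. \<tau> \<le> Z \<omega>} \<omega> \<partial>M) \<le> 2 * exp (- 2 * \<tau>\<^sup>2 / \<sigma>\<^sup>2) * (\<integral>\<omega>. W \<omega> \<partial>M)"
  shows "integrable M (\<lambda>\<omega>. W \<omega> * exp ((Z \<omega>)\<^sup>2 / \<sigma>\<^sup>2))"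
    "(\<integral>\<omega>. W \<omega> * exp ((Z \<omega>)\<^sup>2 / \<sigma>\<^sup>2) \<partial>M) \<le> exp 2 * (\<integral>\<omega>. W \<omega> \<partial>M)"
proof -
  define w where "w = (\<integral>\<omega>. W \<omega> \<partial>M)"
  have w: "0 \<le> w" unfolding w_def by (intro integral_nonneg_AE) (use W in auto)
  have [measurable]: "W \<in> borel_measurable M" using W by auto
  define A where "A m = {\<omega>\<in>space M. \<sigma> * sqrt (real m + 1) \<le> Z \<omega>}" for m
  have A[measurable]: "A m \<in> sets M" for m unfolding A_def by measurable
  define c where "c m = exp (real m + 2) - exp (real m + 1)" for m
  have c: "0 \<le> c m" for m by (simp add: c_def)
  have A_eq: "indicator {real m + 1..} ((Z \<omega>)\<^sup>2 / \<sigma>\<^sup>2) = (indicator (A m) \<omega> :: ennreal)"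
    if "\<omega> \<in> space M" for m \<omega>
  proof -
    have "real m + 1 \<le> (Z \<omega>)\<^sup>2 / \<sigma>\<^sup>2 \<longleftrightarrow> (\<sigma> * sqrt (real m + 1))\<^sup>2 \<le> (Z \<omega>)\<^sup>2"
      using \<sigma> by (simp add: power_mult_distrib field_simps)
    also have "\<dots> \<longleftrightarrow> \<sigma> * sqrt (real m + 1) \<le> Z \<omega>"
      using \<sigma> Z0[of \<omega>] by (intro power2_le_iff_abs_le[THEN trans]) auto
    finally show ?thesis using that by (simp add: A_def indicator_def)
  qed
  have layer: "(\<integral>\<^sup>+\<omega>. ennreal (W \<omega>) * (ennreal (c m) * indicator (A m) \<omega>) \<partial>M)
      \<le> ennreal (2 * (1 - exp (- 1)) * exp (- 1) ^ m * w)" for m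
  proof -
    have int: "integrable M (\<lambda>\<omega>. W \<omega> * indicator (A m) \<omega>)"
      by (rule integrable_mult_indicator[OF A W(1), simplified scaleR_conv_of_real, simplified mult.commute, simplified]) 
    have "(\<integral>\<^sup>+\<omega>. ennreal (W \<omega>) * (ennreal (c m) * indicator (A m) \<omega>) \<partial>M)
        = (\<integral>\<^sup>+\<omega>. ennreal (c m) * ennreal (W \<omega> * indicator (A m) \<omega>) \<partial>M)"
      by (intro nn_integral_cong) (auto simp: indicator_def mult_ac)
    also have "\<dots> = ennreal (c m) * ennreal (\<integral>\<omega>. W \<omega> * indicator (A m) \<omega> \<partial>M)"
      using int W by (subst nn_integral_cmult) (auto simp: nn_integral_eq_integral)
    also have "\<dots> \<le> ennreal (c m) * ennreal (2 * exp (- 2 * (\<sigma> * sqrt (real m + 1))\<^sup>2 / \<sigma>\<^sup>2) * w)"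
      unfolding A_def w_def using \<sigma> by (intro mult_left_mono ennreal_leI tail) auto
    also have "\<dots> = ennreal (c m * (2 * exp (- 2 * (real m + 1)) * w))"
      using c w \<sigma> by (subst ennreal_mult) (auto simp: power_mult_distrib)
    also have "c m * (2 * exp (- 2 * (real m + 1)) * w) = 2 * (1 - exp (- 1)) * exp (- 1) ^ m * w"
    proof -
      have "c m * exp (- 2 * (real m + 1)) = exp (- real m) - exp (- real m - 1)"
        by (simp add: c_def left_diff_distrib flip: exp_add)
      also have "\<dots> = (1 - exp (- 1)) * exp (- real m)"
        by (simp add: left_diff_distrib flip: exp_add)
      also have "exp (- real m) = exp (- 1) ^ m"
        by (simp flip: exp_of_nat_mult)
      finally have e: "c m * exp (- 2 * (real m + 1)) = (1 - exp (- 1)) * exp (- 1) ^ m" .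
      have "c m * (2 * exp (- 2 * (real m + 1)) * w) = 2 * (c m * exp (- 2 * (real m + 1))) * w"
        by (simp only: mult_ac)
      then show ?thesis unfolding e by (simp only: mult_ac)
    qed
    finally show ?thesis .
  qed
  have "(\<integral>\<^sup>+\<omega>. ennreal (W \<omega> * exp ((Z \<omega>)\<^sup>2 / \<sigma>\<^sup>2)) \<partial>M)
      \<le> (\<integral>\<^sup>+\<omega>. ennreal (exp 1) * ennreal (W \<omega>)
            + (\<Sum>m. ennreal (W \<omega>) * (ennreal (c m) * indicator (A m) \<omega>)) \<partial>M)"
  proof (rule nn_integral_mono)
    fix \<omega> assume \<omega>: "\<omega> \<in> space M"
    have "ennreal (W \<omega> * exp ((Z \<omega>)\<^sup>2 / \<sigma>\<^sup>2)) = ennreal (W \<omega>) * ennreal (exp ((Z \<omega>)\<^sup>2 / \<sigma>\<^sup>2))"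
      using W by (simp add: ennreal_mult)
    also have "\<dots> \<le> ennreal (W \<omega>) * (ennreal (exp 1) + (\<Sum>m. ennreal (c m) * indicator (A m) \<omega>))"
      using exp_le_layers[of "(Z \<omega>)\<^sup>2 / \<sigma>\<^sup>2"] unfolding A_eq[OF \<omega>] c_def
      by (intro mult_left_mono) auto
    finally show "ennreal (W \<omega> * exp ((Z \<omega>)\<^sup>2 / \<sigma>\<^sup>2)) \<le> ennreal (exp 1) * ennreal (W \<omega>)
            + (\<Sum>m. ennreal (W \<omega>) * (ennreal (c m) * indicator (A m) \<omega>))"
      by (simp add: distrib_left mult.commute)
  qed
  also have "\<dots> = ennreal (exp 1 * w)
      + (\<Sum>m. \<integral>\<^sup>+\<omega>. ennreal (W \<omega>) * (ennreal (c m) * indicator (A m) \<omega>) \<partial>M)"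
  proof (subst nn_integral_add)
    show "(\<integral>\<^sup>+\<omega>. ennreal (exp 1) * ennreal (W \<omega>) \<partial>M)
        + (\<integral>\<^sup>+\<omega>. (\<Sum>m. ennreal (W \<omega>) * (ennreal (c m) * indicator (A m) \<omega>)) \<partial>M)
      = ennreal (exp 1 * w) + (\<Sum>m. \<integral>\<^sup>+\<omega>. ennreal (W \<omega>) * (ennreal (c m) * indicator (A m) \<omega>) \<partial>M)"
      by (subst nn_integral_suminf)
        (use W w in \<open>auto simp: nn_integral_cmult nn_integral_eq_integral w_def ennreal_mult\<close>)
  qed measurable
  also have "\<dots> \<le> ennreal (exp 1 * w) + (\<Sum>m. ennreal (2 * (1 - exp (- 1)) * exp (- 1) ^ m * w))"
    by (intro add_left_mono suminf_le layer) auto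
  also have "(\<Sum>m. ennreal (2 * (1 - exp (- 1)) * exp (- 1) ^ m * w)) = ennreal (2 * w)"
  proof -
    have "(\<lambda>m. exp (- 1) ^ m) sums (1 / (1 - exp (- 1 :: real)))"
      by (rule geometric_sums) simp
    note sums_mult[OF this, of "2 * (1 - exp (- 1)) * w"]
    moreover have "2 * d * w * (1 / d) = 2 * w" if "d \<noteq> 0" for d
      using that by simp
    from this[of "1 - exp (- 1)"] have "2 * (1 - exp (- 1)) * w * (1 / (1 - exp (- 1))) = 2 * w"
      by simp
    ultimately have "(\<lambda>m. 2 * (1 - exp (- 1)) * w * exp (- 1) ^ m) sums (2 * w)" by (simp only:)
    then have "(\<lambda>m. 2 * (1 - exp (- 1)) * exp (- 1) ^ m * w) sums (2 * w)"
      by (simp only: mult_ac)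
    then show ?thesis using w by (intro sums_unique[symmetric]) (simp add: sums_ennreal)
  qed
  also have "ennreal (exp 1 * w) + ennreal (2 * w) \<le> ennreal (exp 2 * w)"
  proof -
    have "exp (2 :: real) = exp 1 * exp 1" by (simp flip: exp_add)
    moreover have "0 \<le> (exp 1 - 2) * (exp 1 + 1 :: real)"
      using exp_ge_add_one_self[of 1] by (intro mult_nonneg_nonneg) auto
    ultimately have "exp 1 + 2 \<le> exp (2 :: real)" by (simp add: algebra_simps)
    then show ?thesis using w
      by (simp add: mult_right_mono flip: ennreal_plus distrib_right)
  qed
  finally have nn: "(\<integral>\<^sup>+\<omega>. ennreal (W \<omega> * exp ((Z \<omega>)\<^sup>2 / \<sigma>\<^sup>2)) \<partial>M) \<le> ennreal (exp 2 * w)" .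
  then show int: "integrable M (\<lambda>\<omega>. W \<omega> * exp ((Z \<omega>)\<^sup>2 / \<sigma>\<^sup>2))"
    using W by (intro integrableI_nonneg) (auto intro: le_less_trans)
  have "(\<integral>\<omega>. W \<omega> * exp ((Z \<omega>)\<^sup>2 / \<sigma>\<^sup>2) \<partial>M) \<le> exp 2 * w"
    using nn W w by (subst (asm) nn_integral_eq_integral[OF int]) (auto simp: ennreal_le_iff)
  then show "(\<integral>\<omega>. W \<omega> * exp ((Z \<omega>)\<^sup>2 / \<sigma>\<^sup>2) \<partial>M) \<le> exp 2 * (\<integral>\<omega>. W \<omega> \<partial>M)" by (simp add: w_def)
qed

text \<open>The weak form of a conditional moment bound by \<open>exp 2\<close>: testing against
  nonnegative weights \<open>W\<close> measurable for \<open>G\<close> avoids a conditional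
  expectation of a function whose integrability is part of the claim.\<close>

lemma (in prob_space) conditional_exp_square_moment:
  fixes z :: "'a \<Rightarrow> 'b::euclidean_space"
  assumes G: "subalgebra M G" and z[measurable]: "z \<in> borel_measurable M" and \<sigma>: "0 < \<sigma>"
    and tail: "\<And>\<tau>. 0 < \<tau> \<Longrightarrow>
      AE \<omega> in M. conditional_prob M G {\<omega>\<in>space M. \<tau> \<le> norm (z \<omega>)} \<omega> \<le> 2 * exp (- 2 * \<tau>\<^sup>2 / \<sigma>\<^sup>2)"
    and W: "W \<in> borel_measurable G" "integrable M W" "\<And>\<omega>. 0 \<le> W \<omega>"
  shows "integrable M (\<lambda>\<omega>. W \<omega> * exp ((norm (z \<omega>))\<^sup>2 / \<sigma>\<^sup>2))"
    "(\<integral>\<omega>. W \<omega> * exp ((norm (z \<omega>))\<^sup>2 / \<sigma>\<^sup>2) \<partial>M) \<le> exp 2 * (\<integral>\<omega>. W \<omega> \<partial>M)"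
proof -
  interpret finite_measure_subalgebra M G by unfold_locales (rule G)
  have "(\<integral>\<omega>. W \<omega> * indicator {\<omega>\<in>space M. \<tau> \<le> norm (z \<omega>)} \<omega> \<partial>M)
      \<le> 2 * exp (- 2 * \<tau>\<^sup>2 / \<sigma>\<^sup>2) * (\<integral>\<omega>. W \<omega> \<partial>M)" if \<tau>: "0 < \<tau>" for \<tau>
  proof -
    define A where "A = {\<omega>\<in>space M. \<tau> \<le> norm (z \<omega>)}"
    have [measurable]: "A \<in> sets M" unfolding A_def by measurable
    have "integrable M (\<lambda>\<omega>. W \<omega> * indicator A \<omega>)"
      using integrable_mult_indicator[of A M W] W by (simp add: mult.commute)
    note intg = real_cond_exp_intg[OF this W(1)]
    have "(\<integral>\<omega>. W \<omega> * indicator A \<omega> \<partial>M) = (\<integral>\<omega>. W \<omega> * real_cond_exp M G (indicator A) \<omega> \<partial>M)"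
      using intg(2) by simp
    also have "\<dots> \<le> (\<integral>\<omega>. W \<omega> * (2 * exp (- 2 * \<tau>\<^sup>2 / \<sigma>\<^sup>2)) \<partial>M)"
    proof (rule integral_mono_AE)
      show "AE \<omega> in M. W \<omega> * real_cond_exp M G (indicator A) \<omega> \<le> W \<omega> * (2 * exp (- 2 * \<tau>\<^sup>2 / \<sigma>\<^sup>2))"
        using tail[OF \<tau>] unfolding conditional_prob_def A_def[symmetric]
        by eventually_elim (use W in \<open>auto intro!: mult_left_mono\<close>)
    qed (use intg W in auto)
    finally show ?thesis by (simp add: A_def mult_ac)
  qed
  from weighted_exp_square_moment[OF W(2,3) _ _ \<sigma> this]
  show "integrable M (\<lambda>\<omega>. W \<omega> * exp ((norm (z \<omega>))\<^sup>2 / \<sigma>\<^sup>2))"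
    "(\<integral>\<omega>. W \<omega> * exp ((norm (z \<omega>))\<^sup>2 / \<sigma>\<^sup>2) \<partial>M) \<le> exp 2 * (\<integral>\<omega>. W \<omega> \<partial>M)" by auto
qed


text \<open>A conditional bound tested against \<open>W\<close>. In the affine majorant of the
  exponential the linear term integrates to 0 and the factor \<open>exp (- 2)\<close> cancels the
  moment \<open>exp 2\<close>, so at most the integral of \<open>W\<close> remains.\<close>

lemma (in prob_space) conditional_subgaussian_step:
  fixes y z :: "'a \<Rightarrow> 'b::euclidean_space"
  assumes G: "subalgebra M G" and z[measurable]: "z \<in> borel_measurable M" and \<sigma>: "0 < \<sigma>"
    and mean: "AE \<omega> in M. vec_cond_exp M G z \<omega> = 0"
    and tail: "\<And>\<tau>. 0 < \<tau> \<Longrightarrow>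
      AE \<omega> in M. conditional_prob M G {\<omega>\<in>space M. \<tau> \<le> norm (z \<omega>)} \<omega> \<le> 2 * exp (- 2 * \<tau>\<^sup>2 / \<sigma>\<^sup>2)"
    and y[measurable]: "y \<in> borel_measurable G"
    and W: "W \<in> borel_measurable G" "integrable M W" "\<And>\<omega>. 0 \<le> W \<omega>"
  shows "integrable M (\<lambda>\<omega>. W \<omega> * exp (z \<omega> \<bullet> y \<omega> - 2 * (\<sigma>\<^sup>2 * (norm (y \<omega>))\<^sup>2)))"
    "(\<integral>\<omega>. W \<omega> * exp (z \<omega> \<bullet> y \<omega> - 2 * (\<sigma>\<^sup>2 * (norm (y \<omega>))\<^sup>2)) \<partial>M) \<le> (\<integral>\<omega>. W \<omega> \<partial>M)"
proof -
  interpret finite_measure_subalgebra M G by unfold_locales (rule G)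
  have [measurable]: "y \<in> borel_measurable M" "W \<in> borel_measurable M"
    using measurable_from_subalg[OF G y] measurable_from_subalg[OF G W(1)] by blast+
  note [measurable] = W(1)
  define p where "p \<omega> = \<sigma>\<^sup>2 * (norm (y \<omega>))\<^sup>2" for \<omega>
  define X where "X \<omega> = exp ((norm (z \<omega>))\<^sup>2 / \<sigma>\<^sup>2)" for \<omega>
  \<comment> \<open>\<open>y\<close> is unbounded, so the linear term is kept only where
    \<open>p \<le> 1\<close>; there it is dominated by \<open>X\<close> and hence integrable against
    \<open>W\<close>.\<close>
  define c where "c \<omega> = (if p \<omega> \<le> 1 then exp (- 2 * p \<omega>) else 0)" for \<omega>
  define \<theta> where "\<theta> \<omega> = (if p \<omega> \<le> 1 then p \<omega> else 1 / 2)" for \<omega>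
  have [measurable]: "p \<in> borel_measurable G" unfolding p_def[abs_def] by measurable
  have [measurable]: "c \<in> borel_measurable G" "\<theta> \<in> borel_measurable G"
    unfolding c_def[abs_def] \<theta>_def[abs_def] by measurable
  have [measurable]: "c \<in> borel_measurable M" "\<theta> \<in> borel_measurable M" "p \<in> borel_measurable M"
    by (rule measurable_from_subalg[OF G], measurable)+
  have p0: "0 \<le> p \<omega>" for \<omega> by (simp add: p_def)
  have \<theta>: "0 \<le> \<theta> \<omega>" "\<theta> \<omega> \<le> 1" for \<omega> using p0[of \<omega>] by (auto simp: \<theta>_def)
  have moment: "integrable M (\<lambda>\<omega>. V \<omega> * X \<omega>)" "(\<integral>\<omega>. V \<omega> * X \<omega> \<partial>M) \<le> exp 2 * (\<integral>\<omega>. V \<omega> \<partial>M)"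
    if "V \<in> borel_measurable G" "integrable M V" "\<And>\<omega>. 0 \<le> V \<omega>" for V
    unfolding X_def using tail that by (intro conditional_exp_square_moment[OF G z \<sigma>]; blast)+
  have iWX: "integrable M (\<lambda>\<omega>. W \<omega> * X \<omega>)" by (rule moment(1)[OF W])
  have iW\<theta>: "integrable M (\<lambda>\<omega>. W \<omega> * \<theta> \<omega>)"
  proof (rule Bochner_Integration.integrable_bound[OF W(2)])
    show "AE \<omega> in M. norm (W \<omega> * \<theta> \<omega>) \<le> norm (W \<omega>)"
      using W(3) \<theta> by (auto intro!: AE_I2 mult_left_le simp: abs_mult)
  qed measurable
  have m\<theta>: "integrable M (\<lambda>\<omega>. W \<omega> * \<theta> \<omega> * X \<omega>)"
    "(\<integral>\<omega>. W \<omega> * \<theta> \<omega> * X \<omega> \<partial>M) \<le> exp 2 * (\<integral>\<omega>. W \<omega> * \<theta> \<omega> \<partial>M)"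
    by (rule moment[OF _ iW\<theta>]; use W \<theta> in \<open>auto intro!: borel_measurable_times\<close>)+
  have lin_bound: "c \<omega> * (norm (y \<omega>) * norm (z \<omega>)) \<le> X \<omega>" "0 \<le> c \<omega>" for \<omega>
  proof -
    define a where "a = norm (z \<omega>) / \<sigma>"
    have a: "0 \<le> a" using \<sigma> by (simp add: a_def)
    show "c \<omega> * (norm (y \<omega>) * norm (z \<omega>)) \<le> X \<omega>"
    proof (cases "p \<omega> \<le> 1")
      case True
      have "(\<sigma> * norm (y \<omega>))\<^sup>2 \<le> 1\<^sup>2" using True by (simp add: p_def power_mult_distrib)
      then have 1: "\<sigma> * norm (y \<omega>) \<le> 1" by (rule power2_le_imp_le) simp
      have "norm (y \<omega>) * norm (z \<omega>) = (\<sigma> * norm (y \<omega>)) * a" using \<sigma> by (simp add: a_def)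
      also have "\<dots> \<le> 1 * a" using 1 a by (rule mult_right_mono)
      also have "1 * a \<le> 1 + a\<^sup>2" using zero_le_power2[of "a - 1 / 2"]
        by (simp add: power2_eq_square algebra_simps)
      also have "\<dots> \<le> exp (a\<^sup>2)" by (rule exp_ge_add_one_self)
      also have "\<dots> = X \<omega>" by (simp add: X_def a_def power_divide)
      finally have 2: "norm (y \<omega>) * norm (z \<omega>) \<le> X \<omega>" .
      have "c \<omega> \<le> 1" using p0[of \<omega>] by (simp add: c_def)
      then have "c \<omega> * (norm (y \<omega>) * norm (z \<omega>)) \<le> 1 * (norm (y \<omega>) * norm (z \<omega>))"
        by (rule mult_right_mono) simp
      with 2 show ?thesis by simp
    qed (simp add: c_def X_def)
    show "0 \<le> c \<omega>" by (simp add: c_def)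
  qed
  have comp: "integrable M (\<lambda>\<omega>. (W \<omega> * c \<omega> * (y \<omega> \<bullet> b)) * (z \<omega> \<bullet> b))"
    "(\<integral>\<omega>. (W \<omega> * c \<omega> * (y \<omega> \<bullet> b)) * (z \<omega> \<bullet> b) \<partial>M) = 0" if b: "b \<in> Basis" for b
  proof -
    show int: "integrable M (\<lambda>\<omega>. (W \<omega> * c \<omega> * (y \<omega> \<bullet> b)) * (z \<omega> \<bullet> b))"
    proof (rule Bochner_Integration.integrable_bound[OF iWX])
      show "AE \<omega> in M. norm ((W \<omega> * c \<omega> * (y \<omega> \<bullet> b)) * (z \<omega> \<bullet> b)) \<le> norm (W \<omega> * X \<omega>)"
      proof (rule AE_I2)
        fix \<omega>
        have "norm ((W \<omega> * c \<omega> * (y \<omega> \<bullet> b)) * (z \<omega> \<bullet> b)) = W \<omega> * (c \<omega> * (\<bar>y \<omega> \<bullet> b\<bar> * \<bar>z \<omega> \<bullet> b\<bar>))"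
          using W(3)[of \<omega>] lin_bound(2)[of \<omega>] by (simp add: abs_mult mult_ac)
        also have "\<dots> \<le> W \<omega> * (c \<omega> * (norm (y \<omega>) * norm (z \<omega>)))"
          using W(3) lin_bound(2) b by (intro mult_left_mono mult_mono Basis_le_norm) auto
        also have "\<dots> \<le> W \<omega> * X \<omega>" by (intro mult_left_mono lin_bound W)
        finally show "norm ((W \<omega> * c \<omega> * (y \<omega> \<bullet> b)) * (z \<omega> \<bullet> b)) \<le> norm (W \<omega> * X \<omega>)" by simp
      qed
    qed measurable
    have zero: "AE \<omega> in M. real_cond_exp M G (\<lambda>\<omega>. z \<omega> \<bullet> b) \<omega> = 0"
      using mean
    proof eventually_elim
      case (elim \<omega>)
      have "vec_cond_exp M G z \<omega> \<bullet> b = real_cond_exp M G (\<lambda>\<omega>. z \<omega> \<bullet> b) \<omega>"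
        unfolding vec_cond_exp_def using b
        by (simp add: inner_sum_left inner_Basis if_distrib[where f = "\<lambda>c. _ * c"] cong: if_cong)
      with elim show ?case by simp
    qed
    have "(\<integral>\<omega>. (W \<omega> * c \<omega> * (y \<omega> \<bullet> b)) * (z \<omega> \<bullet> b) \<partial>M)
        = (\<integral>\<omega>. (W \<omega> * c \<omega> * (y \<omega> \<bullet> b)) * real_cond_exp M G (\<lambda>\<omega>. z \<omega> \<bullet> b) \<omega> \<partial>M)"
      by (rule real_cond_exp_intg(2)[OF int, symmetric]) measurable
    also have "\<dots> = (\<integral>\<omega>. 0 \<partial>M)"
      by (rule integral_cong_AE) (use zero in \<open>auto intro!: borel_measurable_times elim: eventually_mono\<close>)
    finally show "(\<integral>\<omega>. (W \<omega> * c \<omega> * (y \<omega> \<bullet> b)) * (z \<omega> \<bullet> b) \<partial>M) = 0" by simp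
  qed
  have lin_eq: "W \<omega> * c \<omega> * (z \<omega> \<bullet> y \<omega>) = (\<Sum>b\<in>Basis. (W \<omega> * c \<omega> * (y \<omega> \<bullet> b)) * (z \<omega> \<bullet> b))" for \<omega>
    by (subst euclidean_inner) (simp add: sum_distrib_left mult_ac)
  have lin: "integrable M (\<lambda>\<omega>. W \<omega> * c \<omega> * (z \<omega> \<bullet> y \<omega>))" "(\<integral>\<omega>. W \<omega> * c \<omega> * (z \<omega> \<bullet> y \<omega>) \<partial>M) = 0"
    unfolding lin_eq using comp by (auto simp: Bochner_Integration.integral_sum)
  define B where "B \<omega> = W \<omega> * c \<omega> * (z \<omega> \<bullet> y \<omega>) + (W \<omega> - W \<omega> * \<theta> \<omega>)
      + exp (- 2) * (W \<omega> * \<theta> \<omega> * X \<omega>)" for \<omega>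
  have iB: "integrable M B" unfolding B_def[abs_def]
    by (intro Bochner_Integration.integrable_add Bochner_Integration.integrable_diff
        integrable_mult_right lin W iW\<theta> m\<theta>)
  have le: "W \<omega> * exp (z \<omega> \<bullet> y \<omega> - 2 * (\<sigma>\<^sup>2 * (norm (y \<omega>))\<^sup>2)) \<le> B \<omega>" for \<omega>
  proof -
    have "(z \<omega> \<bullet> y \<omega>)\<^sup>2 \<le> (norm (z \<omega>) * norm (y \<omega>))\<^sup>2"
      using Cauchy_Schwarz_ineq2[of "z \<omega>" "y \<omega>"] by (rule abs_le_square_iff[THEN iffD1, OF order_trans]) simp
    also have "\<dots> = p \<omega> * ((norm (z \<omega>))\<^sup>2 / \<sigma>\<^sup>2)"
      using \<sigma> by (simp add: p_def power_mult_distrib)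
    finally have "exp (z \<omega> \<bullet> y \<omega> - 2 * p \<omega>)
        \<le> c \<omega> * (z \<omega> \<bullet> y \<omega>) + (1 - \<theta> \<omega>) + \<theta> \<omega> * exp ((norm (z \<omega>))\<^sup>2 / \<sigma>\<^sup>2 - 2)"
      unfolding c_def \<theta>_def by (rule exp_subgaussian_affine_bound) (use p0 in auto)
    from mult_left_mono[OF this W(3)[of \<omega>]] show ?thesis
      by (simp add: B_def p_def X_def exp_diff exp_minus algebra_simps divide_inverse)
  qed
  show int: "integrable M (\<lambda>\<omega>. W \<omega> * exp (z \<omega> \<bullet> y \<omega> - 2 * (\<sigma>\<^sup>2 * (norm (y \<omega>))\<^sup>2)))"
  proof (rule Bochner_Integration.integrable_bound[OF iB])
    show "AE \<omega> in M. norm (W \<omega> * exp (z \<omega> \<bullet> y \<omega> - 2 * (\<sigma>\<^sup>2 * (norm (y \<omega>))\<^sup>2))) \<le> norm (B \<omega>)"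
      using W(3) le by (auto intro!: AE_I2 order_trans[OF le abs_ge_self] simp: abs_mult)
  qed measurable
  have "(\<integral>\<omega>. W \<omega> * exp (z \<omega> \<bullet> y \<omega> - 2 * (\<sigma>\<^sup>2 * (norm (y \<omega>))\<^sup>2)) \<partial>M) \<le> (\<integral>\<omega>. B \<omega> \<partial>M)"
    by (intro integral_mono int iB le)
  also have "\<dots> = 0 + ((\<integral>\<omega>. W \<omega> \<partial>M) - (\<integral>\<omega>. W \<omega> * \<theta> \<omega> \<partial>M)) + exp (- 2) * (\<integral>\<omega>. W \<omega> * \<theta> \<omega> * X \<omega> \<partial>M)"
    unfolding B_def using lin W(2) iW\<theta> m\<theta>(1) by simp
  also have "exp (- 2) * (\<integral>\<omega>. W \<omega> * \<theta> \<omega> * X \<omega> \<partial>M) \<le> exp (- 2) * (exp 2 * (\<integral>\<omega>. W \<omega> * \<theta> \<omega> \<partial>M))"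
    by (intro mult_left_mono m\<theta>) simp
  also have "exp (- 2) * (exp 2 * (\<integral>\<omega>. W \<omega> * \<theta> \<omega> \<partial>M)) = (\<integral>\<omega>. W \<omega> * \<theta> \<omega> \<partial>M)"
    by (simp add: exp_minus)
  finally show "(\<integral>\<omega>. W \<omega> * exp (z \<omega> \<bullet> y \<omega> - 2 * (\<sigma>\<^sup>2 * (norm (y \<omega>))\<^sup>2)) \<partial>M) \<le> (\<integral>\<omega>. W \<omega> \<partial>M)" by simp
qed

text \<open>A supermartingale argument: the exponential of the partial sum up to \<open>k\<close> is
  measurable for \<open>G k\<close> and serves as the weight \<open>W\<close> in the next
  step.\<close>

lemma (in prob_space) subgaussian_sum_exp_moment:
  fixes y z :: "nat \<Rightarrow> 'a \<Rightarrow> 'b::euclidean_space"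
  assumes G: "\<And>i. i < n \<Longrightarrow> subalgebra M (G i)"
    and mono: "\<And>i j. i \<le> j \<Longrightarrow> j < n \<Longrightarrow> subalgebra (G j) (G i)"
    and z: "\<And>i. i < n \<Longrightarrow> z i \<in> borel_measurable M"
      "\<And>i j. i < j \<Longrightarrow> j < n \<Longrightarrow> z i \<in> borel_measurable (G j)"
    and y: "\<And>i. i < n \<Longrightarrow> y i \<in> borel_measurable (G i)"
    and \<sigma>: "0 < \<sigma>"
    and mean: "\<And>i. i < n \<Longrightarrow> AE \<omega> in M. vec_cond_exp M (G i) (z i) \<omega> = 0"
    and tail: "\<And>i \<tau>. i < n \<Longrightarrow> 0 < \<tau> \<Longrightarrow> AE \<omega> in M.
      conditional_prob M (G i) {\<omega>\<in>space M. \<tau> \<le> norm (z i \<omega>)} \<omega> \<le> 2 * exp (- 2 * \<tau>\<^sup>2 / \<sigma>\<^sup>2)"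
  shows "(\<integral>\<^sup>+\<omega>. ennreal (exp (\<Sum>i<n. z i \<omega> \<bullet> y i \<omega> - 2 * (\<sigma>\<^sup>2 * (norm (y i \<omega>))\<^sup>2))) \<partial>M) \<le> 1"
proof -
  define T where "T i \<omega> = z i \<omega> \<bullet> y i \<omega> - 2 * (\<sigma>\<^sup>2 * (norm (y i \<omega>))\<^sup>2)" for i \<omega>
  have "integrable M (\<lambda>\<omega>. exp (\<Sum>i<k. T i \<omega>)) \<and> (\<integral>\<omega>. exp (\<Sum>i<k. T i \<omega>) \<partial>M) \<le> 1" if "k \<le> n" for k
    using that
  proof (induction k)
    case 0
    then show ?case by (simp add: prob_space)
  next
    case (Suc k)
    then have k: "k < n" by simp
    define W where "W \<omega> = exp (\<Sum>i<k. T i \<omega>)" for \<omega>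
    have [measurable]: "T i \<in> borel_measurable (G k)" if "i \<in> {..<k}" for i
    proof -
      have i: "i < k" "i \<le> k" "i < n" using that k by auto
      have [measurable]: "z i \<in> borel_measurable (G k)" "y i \<in> borel_measurable (G k)"
        using z(2)[OF i(1) k] measurable_from_subalg[OF mono[OF i(2) k] y[OF i(3)]] by blast+
      show ?thesis unfolding T_def[abs_def] by measurable
    qed
    then have W: "W \<in> borel_measurable (G k)" unfolding W_def[abs_def] by measurable
    have W': "integrable M W" "(\<integral>\<omega>. W \<omega> \<partial>M) \<le> 1" "\<And>\<omega>. 0 \<le> W \<omega>"
      using Suc k by (auto simp: W_def[abs_def])
    have split: "exp (\<Sum>i<Suc k. T i \<omega>) = W \<omega> * exp (z k \<omega> \<bullet> y k \<omega> - 2 * (\<sigma>\<^sup>2 * (norm (y k \<omega>))\<^sup>2))" for \<omega>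
      by (simp add: W_def T_def exp_add)
    from conditional_subgaussian_step[OF G[OF k] z(1)[OF k] \<sigma> mean[OF k] tail[OF k] y[OF k] W W'(1,3)] W'(2)
    show ?case unfolding split by linarith
  qed
  from this[of n] have "integrable M (\<lambda>\<omega>. exp (\<Sum>i<n. T i \<omega>))" "(\<integral>\<omega>. exp (\<Sum>i<n. T i \<omega>) \<partial>M) \<le> 1"
    by auto
  then show ?thesis by (simp add: nn_integral_eq_integral T_def)
qed

lemma (in prob_space) exp_moment_subconvex_combination:
  fixes X :: "'i \<Rightarrow> 'a \<Rightarrow> real"
  assumes I: "finite I" and p: "\<And>i. i \<in> I \<Longrightarrow> 0 \<le> p i" "sum p I \<le> 1"
    and X[measurable]: "\<And>i. i \<in> I \<Longrightarrow> X i \<in> borel_measurable M"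
    and le: "\<And>i. i \<in> I \<Longrightarrow> (\<integral>\<^sup>+\<omega>. ennreal (exp (X i \<omega>)) \<partial>M) \<le> ennreal K" and K: "1 \<le> K"
  shows "(\<integral>\<^sup>+\<omega>. ennreal (exp (\<Sum>i\<in>I. p i * X i \<omega>)) \<partial>M) \<le> ennreal K"
proof -
  have "exp (\<Sum>i\<in>I. p i * X i \<omega>) \<le> (1 - sum p I) + (\<Sum>i\<in>I. p i * exp (X i \<omega>))" for \<omega>
  proof -
    \<comment> \<open>The index \<open>None\<close> carries the missing mass
      \<open>1 - sum p I\<close> at value 0, where \<open>exp\<close> is 1 and thus at most
      \<open>K\<close>.\<close>
    define q where "q j = (case j of None \<Rightarrow> 1 - sum p I | Some i \<Rightarrow> p i)" for j
    define v where "v j = (case j of None \<Rightarrow> 0 | Some i \<Rightarrow> X i \<omega>)" for j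
    have J: "finite (insert None (Some ` I))" "None \<notin> Some ` I" using I by auto
    have "exp (\<Sum>j\<in>insert None (Some ` I). q j *\<^sub>R v j) \<le> (\<Sum>j\<in>insert None (Some ` I). q j * exp (v j))"
    proof (rule convex_on_sum[OF _ _ exp_convex])
      show "(\<Sum>j\<in>insert None (Some ` I). q j) = 1"
        using J I by (simp add: q_def sum.reindex)
    qed (use J p in \<open>auto simp: q_def\<close>)
    then show ?thesis using J I by (simp add: q_def v_def sum.reindex)
  qed
  then have "(\<integral>\<^sup>+\<omega>. ennreal (exp (\<Sum>i\<in>I. p i * X i \<omega>)) \<partial>M)
      \<le> (\<integral>\<^sup>+\<omega>. ennreal (1 - sum p I) + (\<Sum>i\<in>I. ennreal (p i) * ennreal (exp (X i \<omega>))) \<partial>M)"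
    using p by (intro nn_integral_mono)
      (simp add: sum_nonneg flip: ennreal_plus ennreal_mult cong: sum.cong)
  also have "\<dots> = ennreal (1 - sum p I) + (\<Sum>i\<in>I. ennreal (p i) * (\<integral>\<^sup>+\<omega>. ennreal (exp (X i \<omega>)) \<partial>M))"
    by (simp add: nn_integral_add nn_integral_sum nn_integral_cmult emeasure_space_1)
  also have "\<dots> \<le> ennreal (1 - sum p I) * ennreal K + (\<Sum>i\<in>I. ennreal (p i) * ennreal K)"
  proof (intro add_mono sum_mono mult_left_mono le)
    show "ennreal (1 - sum p I) \<le> ennreal (1 - sum p I) * ennreal K"
      using K p by (simp add: mult_le_cancel_left1 flip: ennreal_mult)
  qed auto
  also have "\<dots> = ennreal (1 - sum p I) * ennreal K + ennreal (sum p I) * ennreal K"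
    using p by (simp add: sum_distrib_right[symmetric])
  also have "\<dots> = ennreal K"
    using p K by (simp add: sum_nonneg flip: distrib_right ennreal_plus)
  finally show ?thesis .
qed

lemma (in prob_space) exp_moment_imp_tail:
  assumes T[measurable]: "T \<in> borel_measurable M"
    and le: "(\<integral>\<^sup>+\<omega>. ennreal (exp (T \<omega>)) \<partial>M) \<le> ennreal (exp a)" and \<delta>: "0 < \<delta>"
  shows "1 - \<delta> \<le> prob {\<omega>\<in>space M. T \<omega> \<le> a + ln (1 / \<delta>)}"
proof -
  define A where "A = {\<omega>\<in>space M. a + ln (1 / \<delta>) < T \<omega>}"
  have [measurable]: "A \<in> sets M" unfolding A_def by measurable
  have "ennreal (exp a / \<delta>) * emeasure M A = (\<integral>\<^sup>+\<omega>. ennreal (exp a / \<delta>) * indicator A \<omega> \<partial>M)"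
    by (simp add: nn_integral_cmult_indicator)
  also have "\<dots> \<le> (\<integral>\<^sup>+\<omega>. ennreal (exp (T \<omega>)) \<partial>M)"
  proof (intro nn_integral_mono)
    fix \<omega>
    have "exp a / \<delta> \<le> exp (T \<omega>)" if "\<omega> \<in> A"
    proof -
      have "exp a / \<delta> = exp (a + ln (1 / \<delta>))" using \<delta> by (simp add: exp_add exp_ln)
      also have "\<dots> \<le> exp (T \<omega>)" using that by (simp add: A_def)
      finally show ?thesis .
    qed
    then show "ennreal (exp a / \<delta>) * indicator A \<omega> \<le> ennreal (exp (T \<omega>))"
      by (auto simp: indicator_def intro: ennreal_leI)
  qed
  also note le
  finally have "ennreal (exp a / \<delta>) * ennreal (prob A) \<le> ennreal (exp a)"
    unfolding emeasure_eq_measure .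
  then have "ennreal (exp a / \<delta> * prob A) \<le> ennreal (exp a)"
    using \<delta> by (subst ennreal_mult) auto
  then have "exp a / \<delta> * prob A \<le> exp a" by (subst (asm) ennreal_le_iff) auto
  then have "prob A \<le> \<delta>" using \<delta> by (simp add: field_simps)
  moreover have "prob (space M - A) = 1 - prob A" by (rule prob_compl) simp
  moreover have "space M - A = {\<omega>\<in>space M. T \<omega> \<le> a + ln (1 / \<delta>)}" by (auto simp: A_def)
  ultimately show ?thesis by simp
qed

subsection \<open>The tail bound\<close>

lemma subalgebra_sigma_join:
  assumes "subalgebra N G" "Y \<in> borel_measurable N"
  shows "subalgebra N (sigma_join G Y)"
proof -
  have sp: "space N = space G" using assms(1) by (simp add: subalgebra_def)
  have "sets (vimage_algebra (space G) Y borel) \<subseteq> sets N"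
    using measurable_sets[OF assms(2)] by (auto simp: sets_vimage_algebra2 sp)
  then have "sigma_sets (space N) (sets G \<union> sets (vimage_algebra (space G) Y borel)) \<subseteq> sets N"
    using assms(1) by (intro sets.sigma_sets_subset) (auto simp: subalgebra_def)
  moreover have "sets G \<union> sets (vimage_algebra (space G) Y borel) \<subseteq> Pow (space G)"
    using sets.space_closed[of G] sets.space_closed[of "vimage_algebra (space G) Y borel"] by auto
  ultimately show ?thesis
    unfolding subalgebra_def sigma_join_def using sp by (simp add: space_measure_of_conv)
qed

lemma sigma_join_upper:
  shows "subalgebra (sigma_join G Y) G" "Y \<in> borel_measurable (sigma_join G Y)"
proof -
  have "sets G \<union> sets (vimage_algebra (space G) Y borel) \<subseteq> Pow (space G)"
    using sets.space_closed[of G] sets.space_closed[of "vimage_algebra (space G) Y borel"] by auto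
  then have sp: "space (sigma_join G Y) = space G"
    and sub: "sets G \<union> sets (vimage_algebra (space G) Y borel) \<subseteq> sets (sigma_join G Y)"
    unfolding sigma_join_def by (auto simp: space_measure_of_conv)
  show "subalgebra (sigma_join G Y) G" using sp sub by (simp add: subalgebra_def)
  show "Y \<in> borel_measurable (sigma_join G Y)"
  proof (rule measurableI)
    fix A :: "'b set" assume "A \<in> sets borel"
    then have "Y -` A \<inter> space G \<in> sets (vimage_algebra (space G) Y borel)"
      by (auto simp: sets_vimage_algebra2)
    then show "Y -` A \<inter> space (sigma_join G Y) \<in> sets (sigma_join G Y)" using sp sub by auto
  qed simp
qed

lemma subalgebra_trans: "subalgebra N H \<Longrightarrow> subalgebra H G \<Longrightarrow> subalgebra N G"
  by (auto simp: subalgebra_def)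

lemma sigma_join_mono: "subalgebra H G \<Longrightarrow> subalgebra (sigma_join H Y) (sigma_join G Y)"
  by (intro subalgebra_sigma_join subalgebra_trans[OF sigma_join_upper(1)] sigma_join_upper(2))

text \<open>A finite exponential moment rules out infinite drift almost everywhere, so the drift can
  be replaced by its real part; on the null set \<open>enn2real\<close> returns 0, which only lowers
  the integrand.\<close>

lemma exp_ennreal_moment_imp:
  assumes D[measurable]: "D \<in> borel_measurable M" and \<theta>: "0 < \<theta>"
    and le: "(\<integral>\<^sup>+\<omega>. exp_ennreal (ennreal \<theta> * (D \<omega>)\<^sup>2) \<partial>M) \<le> ennreal K"
  shows "AE \<omega> in M. D \<omega> \<noteq> \<infinity>"
    "(\<integral>\<^sup>+\<omega>. ennreal (exp (\<theta> * (enn2real (D \<omega>))\<^sup>2)) \<partial>M) \<le> ennreal K"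
proof -
  define A where "A = {\<omega>\<in>space M. D \<omega> = \<infinity>}"
  have A[measurable]: "A \<in> sets M" unfolding A_def by measurable
  have top: "exp_ennreal (ennreal \<theta> * \<infinity>\<^sup>2) = \<infinity>"
    using \<theta> by (simp add: exp_ennreal_def ennreal_mult_top power2_eq_square)
  have "\<infinity> * emeasure M A = (\<integral>\<^sup>+\<omega>. \<infinity> * indicator A \<omega> \<partial>M)"
    by (rule nn_integral_cmult_indicator[symmetric, OF A])
  also have "\<dots> \<le> (\<integral>\<^sup>+\<omega>. exp_ennreal (ennreal \<theta> * (D \<omega>)\<^sup>2) \<partial>M)"
    using top by (intro nn_integral_mono) (auto simp: A_def indicator_def)
  also have "\<dots> \<le> ennreal K" by (rule le)
  finally have "emeasure M A = 0"
    by (auto simp: ennreal_top_mult top_unique split: if_splits)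
  then show "AE \<omega> in M. D \<omega> \<noteq> \<infinity>"
    by (subst AE_iff_measurable[OF A]) (auto simp: A_def)
  have "(\<integral>\<^sup>+\<omega>. ennreal (exp (\<theta> * (enn2real (D \<omega>))\<^sup>2)) \<partial>M) \<le> (\<integral>\<^sup>+\<omega>. exp_ennreal (ennreal \<theta> * (D \<omega>)\<^sup>2) \<partial>M)"
  proof (rule nn_integral_mono)
    fix \<omega>
    show "ennreal (exp (\<theta> * (enn2real (D \<omega>))\<^sup>2)) \<le> exp_ennreal (ennreal \<theta> * (D \<omega>)\<^sup>2)"
    proof (cases "D \<omega> = \<infinity>")
      case True
      then show ?thesis by (simp add: top[simplified])
    next
      case False
      then obtain a where a: "0 \<le> a" "D \<omega> = ennreal a" by (cases "D \<omega>") auto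
      then have "ennreal \<theta> * (D \<omega>)\<^sup>2 = ennreal (\<theta> * a\<^sup>2)"
        using \<theta> by (simp add: ennreal_mult ennreal_power)
      then show ?thesis using a \<theta> by (simp add: exp_ennreal_def)
    qed
  qed
  with le show "(\<integral>\<^sup>+\<omega>. ennreal (exp (\<theta> * (enn2real (D \<omega>))\<^sup>2)) \<partial>M) \<le> ennreal K" by (rule order_trans[rotated])
qed

text \<open>At scale \<open>s\<close> the compensator costs
  \<open>2 * \<sigma>\<^sup>2 * (\<rho> * w)\<^sup>2 / s\<close> times the squared norm of
  \<open>v\<close>. From \<open>w \<le> 2 * (1 - \<rho>) ^ k\<close>,
  \<open>\<rho> \<le> 2 / 3 * (m * \<eta>)\<close> and \<open>1 - \<rho> \<ge> 2 / 3\<close>, the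
  available negative term covers this cost for
  \<open>s = 32 * (\<eta> * \<sigma>\<^sup>2)\<close>.\<close>

lemma noise_term_le:
  fixes z v :: "'a::real_inner" and \<rho> m \<eta> \<sigma> :: real and k :: nat
  assumes \<rho>: "0 < \<rho>" "\<rho> \<le> 1 / 3" "\<rho> \<le> 2 / 3 * (m * \<eta>)" and \<eta>: "0 < \<eta>" and \<sigma>: "0 < \<sigma>" and m: "0 < m"
  defines "w \<equiv> (2 - (1 - \<rho>) ^ k) * (1 - \<rho>) ^ k" and "s \<equiv> 32 * (\<eta> * \<sigma>\<^sup>2)"
  shows "\<rho> * w * (z \<bullet> v) - \<rho> * (1 - \<rho>) ^ (2 * k + 1) * (m / 4 * (norm v)\<^sup>2)
    \<le> s * (z \<bullet> ((\<rho> * w / s) *\<^sub>R v) - 2 * (\<sigma>\<^sup>2 * (norm ((\<rho> * w / s) *\<^sub>R v))\<^sup>2))"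
proof -
  define \<kappa> where "\<kappa> = (1 - \<rho>) ^ k"
  have \<kappa>: "0 \<le> \<kappa>" "\<kappa> \<le> 1" using \<rho> by (auto simp: \<kappa>_def power_le_one)
  have s: "0 < s" using \<eta> \<sigma> by (simp add: s_def)
  have "w \<le> 2 * \<kappa>" "0 \<le> w" using \<kappa> by (auto simp: w_def \<kappa>_def[symmetric] mult_right_mono)
  then have "w\<^sup>2 \<le> (2 * \<kappa>)\<^sup>2" by (intro power_mono)
  then have "\<rho> * (\<rho> * w\<^sup>2) \<le> \<rho> * (2 / 3 * (m * \<eta>) * (2 * \<kappa>)\<^sup>2)"
    using \<rho> m \<eta> by (intro mult_left_mono mult_mono) auto
  also have "\<dots> = \<rho> * \<kappa>\<^sup>2 * (4 * m * \<eta>) * (2 / 3)" by (simp add: power2_eq_square)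
  also have "\<dots> \<le> \<rho> * \<kappa>\<^sup>2 * (4 * m * \<eta>) * (1 - \<rho>)"
    using \<rho> m \<eta> by (intro mult_left_mono) auto
  also have "\<dots> = 16 * \<eta> * (\<rho> * \<kappa>\<^sup>2 * (1 - \<rho>) * (m / 4))" by (simp add: algebra_simps)
  also have "\<rho> * (\<rho> * w\<^sup>2) = \<rho>\<^sup>2 * w\<^sup>2" by (simp add: power2_eq_square)
  finally have "\<rho>\<^sup>2 * w\<^sup>2 \<le> 16 * \<eta> * (\<rho> * \<kappa>\<^sup>2 * (1 - \<rho>) * (m / 4))" .
  then have 1: "\<rho>\<^sup>2 * w\<^sup>2 / (16 * \<eta>) \<le> \<rho> * \<kappa>\<^sup>2 * (1 - \<rho>) * (m / 4)"
    using \<eta> by (simp add: pos_divide_le_eq mult_ac)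
  have 2: "s * (2 * (\<sigma>\<^sup>2 * (\<rho> * w / s)\<^sup>2)) = \<rho>\<^sup>2 * w\<^sup>2 / (16 * \<eta>)"
    using \<eta> \<sigma> by (simp add: s_def power2_eq_square)
  have 3: "(norm ((\<rho> * w / s) *\<^sub>R v))\<^sup>2 = (\<rho> * w / s)\<^sup>2 * (norm v)\<^sup>2"
    by (simp add: power_mult_distrib power_divide)
  have "s * (z \<bullet> ((\<rho> * w / s) *\<^sub>R v) - 2 * (\<sigma>\<^sup>2 * (norm ((\<rho> * w / s) *\<^sub>R v))\<^sup>2))
      = \<rho> * w * (z \<bullet> v) - (s * (2 * (\<sigma>\<^sup>2 * (\<rho> * w / s)\<^sup>2))) * (norm v)\<^sup>2"
    unfolding 3 right_diff_distrib using s by simp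
  also have "\<dots> = \<rho> * w * (z \<bullet> v) - \<rho>\<^sup>2 * w\<^sup>2 / (16 * \<eta>) * (norm v)\<^sup>2"
    unfolding 2 ..
  finally have 4: "s * (z \<bullet> ((\<rho> * w / s) *\<^sub>R v) - 2 * (\<sigma>\<^sup>2 * (norm ((\<rho> * w / s) *\<^sub>R v))\<^sup>2))
      = \<rho> * w * (z \<bullet> v) - \<rho>\<^sup>2 * w\<^sup>2 / (16 * \<eta>) * (norm v)\<^sup>2" .
  have "(1 - \<rho>) ^ (2 * k + 1) = \<kappa>\<^sup>2 * (1 - \<rho>)"
    by (simp add: \<kappa>_def power_mult[symmetric] mult.commute)
  then have 5: "\<rho> * (1 - \<rho>) ^ (2 * k + 1) * (m / 4 * (norm v)\<^sup>2)
      = \<rho> * \<kappa>\<^sup>2 * (1 - \<rho>) * (m / 4) * (norm v)\<^sup>2" by (simp only: mult.assoc)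
  show ?thesis unfolding 4 5 using mult_right_mono[OF 1, of "(norm v)\<^sup>2"] by simp
qed

text \<open>The case of positive \<open>t\<close> and finite initial gap, still in terms of \<rho>.
  Four random quantities are put on scales on which their exponential moments are at most
  \<open>exp 2\<close>; the sum of the scales multiplies the deviation.\<close>

lemma high_probability_gap_bound:
  fixes f :: "'w \<Rightarrow> nat \<Rightarrow> 'a::euclidean_space \<Rightarrow> 'a \<Rightarrow> real" and \<mu> \<gamma> \<eta> \<Delta> \<sigma> :: real
  assumes psg: "averaged_decision_dependent_psg M F \<mu> L \<gamma> f r (\<lambda>_. \<eta>) x xhat xbar g"
    and \<eta>: "0 < \<eta>" "\<eta> \<le> 1 / (2 * L)"
    and r_const: "\<And>\<omega> s t. \<omega> \<in> space M \<Longrightarrow> r \<omega> s = r \<omega> t" and t: "0 < t"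
    and \<Delta>: "0 < \<Delta>" and \<sigma>: "0 < \<sigma>"
    and drift: "\<And>i. i < t \<Longrightarrow> (\<integral>\<^sup>+ \<omega>. exp_ennreal (ennreal (1 / ((\<mu> - 2 * \<gamma>) * \<Delta> * real (t - i))\<^sup>2)
          * (gradient_drift f i t \<omega>)\<^sup>2) \<partial>M) \<le> ennreal (exp 1)"
    and mean: "\<And>i. i < t \<Longrightarrow>
        AE \<omega> in M. vec_cond_exp M (sigma_join (F i) (xbar t)) (gradient_noise f x g i) \<omega> = 0"
    and tail: "\<And>i \<tau>. i < t \<Longrightarrow> 0 < \<tau> \<Longrightarrow> AE \<omega> in M.
          conditional_prob M (sigma_join (F i) (xbar t))
              {\<omega>' \<in> space M. \<tau> \<le> norm (gradient_noise f x g i \<omega>')} \<omega> \<le> 2 * exp (- 2 * \<tau>\<^sup>2 / \<sigma>\<^sup>2)"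
    and d: "\<And>\<omega>. \<omega> \<in> space M \<Longrightarrow> equilibrium_gap f r xbar x 0 \<omega> = ereal d"
    and \<delta>: "0 < \<delta>"
  defines "\<rho> \<equiv> (\<mu> - 2 * \<gamma>) * \<eta> / (2 - \<mu> * \<eta>)"
  shows "1 - \<delta> \<le> measure M {\<omega> \<in> space M. equilibrium_gap f r xbar xhat t \<omega> \<le>
     ereal (6 * (1 - \<rho>) ^ t * d
       + (34 * (\<eta> * \<sigma>\<^sup>2) + 52 * ((\<mu> - 2 * \<gamma>) * \<Delta>\<^sup>2 / \<rho>\<^sup>2)) * (2 + ln (1 / \<delta>)))}"
proof -
  interpret averaged_decision_dependent_psg M F \<mu> L \<gamma> f r "\<lambda>_. \<eta>" x xhat xbar g by (rule psg)
  obtain \<omega>0 where \<omega>0: "\<omega>0 \<in> space M" using not_empty by blast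
  have \<gamma>: "0 \<le> \<gamma>" by (rule gradient_sensitivityD(2)[OF gamma_eq \<omega>0])
  have "\<mu> * \<eta> \<le> 1 / 2"
    by (rule strong_convexity_step_size_le[OF loss_strongly_convex[OF \<omega>0] loss_smooth[OF \<omega>0] L_pos \<eta>])
  note \<rho> = averaging_weight_bounds[OF \<gamma> gamma_less \<eta>(1) this, folded \<rho>_def]
  define m where "m = \<mu> - 2 * \<gamma>"
  have m: "0 < m" "m \<le> \<mu>" using gamma_less \<gamma> by (auto simp: m_def)
  define w where "w i = (2 - (1 - \<rho>) ^ (t - 1 - i)) * (1 - \<rho>) ^ (t - 1 - i)" for i
  have \<kappa>: "0 \<le> (1 - \<rho>) ^ k" "(1 - \<rho>) ^ k \<le> 1" for k using \<rho> by (auto simp: power_le_one)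
  have w: "0 \<le> w i" "w i \<le> 2 * (1 - \<rho>) ^ (t - Suc i)" for i
    using \<kappa>[of "t - Suc i"] by (auto simp: w_def mult_right_mono)
  \<comment> \<open>\<open>s1\<close> comes from absorbing the variance, \<open>s2\<close> and
    \<open>s3\<close> make the weights of the single terms sum to at most 1, and in
    \<open>s4\<close> the number is \<open>48 = 3 * 8 * 2\<close>, from the initial comparison and
    the bound \<open>2 / \<rho>\<^sup>2\<close> on
    \<open>(1 - \<rho>) ^ t * t\<^sup>2\<close>.\<close>
  define s1 s2 s3 s4 s where "s1 = 32 * (\<eta> * \<sigma>\<^sup>2)" and "s2 = 2 * (\<eta> * \<sigma>\<^sup>2)"
    and "s3 = 4 * (m * \<Delta>\<^sup>2 / \<rho>\<^sup>2)" and "s4 = 48 * (m * \<Delta>\<^sup>2 / \<rho>\<^sup>2)" and "s = s1 + s2 + s3 + s4"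
  have s: "0 < s1" "0 < s2" "0 < s3" "0 < s4" "0 < s"
    using \<eta> \<sigma> m \<Delta> \<rho> by (auto simp: s1_def s2_def s3_def s4_def s_def intro!: add_pos_pos)
  define z where "z i = gradient_noise f x g i" for i
  define v where "v i \<omega> = x i \<omega> - xbar t \<omega>" for i \<omega>
  define y where "y i \<omega> = (\<rho> * w i / s1) *\<^sub>R v i \<omega>" for i \<omega>
  define G where "G i \<omega> = enn2real (gradient_drift f i t \<omega>)" for i \<omega>
  define b where "b i = 1 / (m * \<Delta> * real (t - i))\<^sup>2" for i
  have b: "0 < b i" if "i < t" for i using m \<Delta> that by (simp add: b_def)
  define c3 where "c3 i = \<rho> * w i * m * \<Delta>\<^sup>2 * (real (t - i))\<^sup>2 / s3" for i
  define X1 where "X1 \<omega> = (\<Sum>i<t. z i \<omega> \<bullet> y i \<omega> - 2 * (\<sigma>\<^sup>2 * (norm (y i \<omega>))\<^sup>2))" for \<omega>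
  define X2 where "X2 \<omega> = (\<Sum>i<t. \<rho> * w i / 2 * ((norm (z i \<omega>))\<^sup>2 / \<sigma>\<^sup>2))" for \<omega>
  define X3 where "X3 \<omega> = (\<Sum>i<t. c3 i * (b i * (G i \<omega>)\<^sup>2))" for \<omega>
  define X4 where "X4 \<omega> = b 0 * (G 0 \<omega>)\<^sup>2" for \<omega>
  \<comment> \<open>Enlarging every \<open>F i\<close> by the same \<open>xbar t\<close> keeps the
    family increasing and makes the multiplier \<open>y i\<close> known before the noise
    \<open>z i\<close>.\<close>
  define Fj where "Fj i = sigma_join (F i) (xbar t)" for i

  have FM: "subalgebra (F j) (F i)" if "i \<le> j" for i j
    using sets_F_mono[OF that] by (simp add: subalgebra_def space_F)
  have z_F: "z i \<in> borel_measurable (F j)" if "i < j" for i j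
    unfolding z_def using measurable_from_subalg[OF FM noise_measurable, of i j] that by auto
  have z_M[measurable]: "z i \<in> borel_measurable M" for i
    by (rule measurable_from_subalg[OF subalgebra z_F[OF lessI]])
  have [measurable]: "x i \<in> borel_measurable M" "xbar i \<in> borel_measurable M" for i
    by (rule measurable_from_subalg[OF subalgebra x_measurable])
      (rule measurable_from_subalg[OF subalgebra xbar_measurable])
  have [measurable]: "y i \<in> borel_measurable M" for i
    unfolding y_def[abs_def] v_def by measurable
  have [measurable]: "G i \<in> borel_measurable M" for i
    unfolding G_def[abs_def] using drift_measurable[of i t] by measurable
  have X_meas[measurable]: "X1 \<in> borel_measurable M" "X2 \<in> borel_measurable M"
    "X3 \<in> borel_measurable M" "X4 \<in> borel_measurable M"
    unfolding X1_def[abs_def] X2_def[abs_def] X3_def[abs_def] X4_def[abs_def] by measurable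

  have Fj_M: "subalgebra M (Fj i)" for i
    unfolding Fj_def by (rule subalgebra_sigma_join[OF subalgebra]) measurable
  have Fj_mono: "subalgebra (Fj j) (Fj i)" if "i \<le> j" for i j
    unfolding Fj_def by (rule sigma_join_mono[OF FM[OF that]])
  have F_Fj: "h \<in> borel_measurable (Fj i)" if "h \<in> borel_measurable (F i)" for h :: "'w \<Rightarrow> 'a" and i
    unfolding Fj_def by (rule measurable_from_subalg[OF sigma_join_upper(1) that])

  have m1: "(\<integral>\<^sup>+\<omega>. ennreal (exp (X1 \<omega>)) \<partial>M) \<le> 1"
    unfolding X1_def
  proof (rule subgaussian_sum_exp_moment[where G = Fj])
    fix i assume "i < t"
    have [measurable]: "x i \<in> borel_measurable (Fj i)" "xbar t \<in> borel_measurable (Fj i)"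
      using F_Fj[OF x_measurable] sigma_join_upper(2) by (auto simp: Fj_def)
    show "y i \<in> borel_measurable (Fj i)" unfolding y_def[abs_def] v_def by measurable
  qed (use Fj_M Fj_mono z_M F_Fj[OF z_F] \<sigma> mean tail in \<open>auto simp: Fj_def z_def\<close>)

  have m2: "(\<integral>\<^sup>+\<omega>. ennreal (exp (X2 \<omega>)) \<partial>M) \<le> ennreal (exp 2)"
    unfolding X2_def
  proof (rule exp_moment_subconvex_combination)
    have "(\<Sum>i<t. \<rho> * w i / 2) \<le> (\<Sum>i<t. \<rho> * (1 - \<rho>) ^ (t - Suc i))"
    proof (rule sum_mono)
      fix i show "\<rho> * w i / 2 \<le> \<rho> * (1 - \<rho>) ^ (t - Suc i)" using w[of i] \<rho> by simp
    qed
    also have "\<dots> = (\<Sum>i<t. \<rho> * (1 - \<rho>) ^ i)"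
      by (rule sum.nat_diff_reindex)
    also have "\<dots> \<le> 1" using sum_geometric_weights_le[of "1 - \<rho>" t] \<rho> by simp
    finally show "(\<Sum>i<t. \<rho> * w i / 2) \<le> 1" .
    fix i assume "i \<in> {..<t}"
    then have i: "i < t" by simp
    show "0 \<le> \<rho> * w i / 2" using \<rho> w by simp
    have mom: "integrable M (\<lambda>\<omega>. 1 * exp ((norm (z i \<omega>))\<^sup>2 / \<sigma>\<^sup>2))"
      "(\<integral>\<omega>. 1 * exp ((norm (z i \<omega>))\<^sup>2 / \<sigma>\<^sup>2) \<partial>M) \<le> exp 2 * (\<integral>\<omega>. 1 \<partial>M)"
      by (rule conditional_exp_square_moment[OF Fj_M z_M \<sigma>];
          use tail[OF i] in \<open>auto simp: Fj_def z_def\<close>)+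
    then show "(\<integral>\<^sup>+\<omega>. ennreal (exp ((norm (z i \<omega>))\<^sup>2 / \<sigma>\<^sup>2)) \<partial>M) \<le> ennreal (exp 2)"
      by (simp add: nn_integral_eq_integral prob_space)
  qed auto

  note dm = exp_ennreal_moment_imp[OF drift_measurable _ drift[folded m_def], folded b_def]
  have fin: "AE \<omega> in M. \<forall>i<t. gradient_drift f i t \<omega> \<noteq> \<infinity>"
    unfolding AE_all_countable using dm(1) b by auto
  have mG: "(\<integral>\<^sup>+\<omega>. ennreal (exp (b i * (G i \<omega>)\<^sup>2)) \<partial>M) \<le> ennreal (exp 2)" if "i < t" for i
  proof -
    have "(\<integral>\<^sup>+\<omega>. ennreal (exp (b i * (G i \<omega>)\<^sup>2)) \<partial>M) \<le> ennreal (exp 1)"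
      unfolding G_def using dm(2) b that by auto
    also have "\<dots> \<le> ennreal (exp 2)" by (intro ennreal_leI) simp
    finally show ?thesis .
  qed
  have m3: "(\<integral>\<^sup>+\<omega>. ennreal (exp (X3 \<omega>)) \<partial>M) \<le> ennreal (exp 2)"
    unfolding X3_def
  proof (rule exp_moment_subconvex_combination)
    have "(\<Sum>i<t. c3 i) \<le> (\<Sum>i<t. \<rho>\<^sup>2 / 2 * (\<rho> * (1 - \<rho>) ^ (t - Suc i) * (real (t - Suc i) + 1)\<^sup>2))"
    proof (rule sum_mono)
      fix i assume "i \<in> {..<t}"
      \<comment> \<open>The drift spans one step more than the exponent of the weight, hence the
        shifted square.\<close>
      then have ti: "real (t - i) = real (t - Suc i) + 1" by simp
      have "c3 i = \<rho>\<^sup>2 / 4 * (\<rho> * w i * (real (t - Suc i) + 1)\<^sup>2)"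
        unfolding c3_def s3_def ti using m \<Delta> \<rho> by (simp add: field_simps)
      also have "\<dots> \<le> \<rho>\<^sup>2 / 4 * (\<rho> * (2 * (1 - \<rho>) ^ (t - Suc i)) * (real (t - Suc i) + 1)\<^sup>2)"
        using w[of i] \<rho> by (intro mult_left_mono mult_right_mono) auto
      finally show "c3 i \<le> \<rho>\<^sup>2 / 2 * (\<rho> * (1 - \<rho>) ^ (t - Suc i) * (real (t - Suc i) + 1)\<^sup>2)"
        by (simp add: mult_ac)
    qed
    also have "\<dots> = \<rho>\<^sup>2 / 2 * (\<Sum>i<t. \<rho> * (1 - \<rho>) ^ (t - Suc i) * (real (t - Suc i) + 1)\<^sup>2)"
      by (rule sum_distrib_left[symmetric])
    also have "(\<Sum>i<t. \<rho> * (1 - \<rho>) ^ (t - Suc i) * (real (t - Suc i) + 1)\<^sup>2)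
        = (\<Sum>i<t. \<rho> * (1 - \<rho>) ^ i * (real i + 1)\<^sup>2)"
      by (rule sum.nat_diff_reindex)
    also have "\<dots> \<le> 2 / \<rho>\<^sup>2"
      using sum_quadratic_geometric_weights_le[of "1 - \<rho>" t] \<rho> by simp
    finally show "(\<Sum>i<t. c3 i) \<le> 1" using \<rho> by (simp add: mult_left_mono)
    fix i assume "i \<in> {..<t}"
    then show "(\<integral>\<^sup>+\<omega>. ennreal (exp (b i * (G i \<omega>)\<^sup>2)) \<partial>M) \<le> ennreal (exp 2)" using mG by simp
    show "0 \<le> c3 i" unfolding c3_def using \<rho> w[of i] m s by simp
  qed auto
  have m4: "(\<integral>\<^sup>+\<omega>. ennreal (exp (X4 \<omega>)) \<partial>M) \<le> ennreal (exp 2)"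
    unfolding X4_def by (rule mG[OF t])

  define X where "X j = [X1, X2, X3, X4] ! j" for j
  \<comment> \<open>Weights proportional to the scales, so that \<open>s * T\<close> is the sum of
    the four scaled quantities.\<close>
  define p where "p j = [s1, s2, s3, s4] ! j / s" for j
  define T where "T \<omega> = (\<Sum>j<4. p j * X j \<omega>)" for \<omega>
  have X_simps: "X 0 = X1" "X 1 = X2" "X 2 = X3" "X 3 = X4"
    and p_simps: "p 0 = s1 / s" "p 1 = s2 / s" "p 2 = s3 / s" "p 3 = s4 / s"
    by (simp_all add: X_def p_def)
  have four: "{..<4::nat} = {0, 1, 2, 3}" by auto
  have T_eq: "s * T \<omega> = s1 * X1 \<omega> + s2 * X2 \<omega> + s3 * X3 \<omega> + s4 * X4 \<omega>" for \<omega>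
    unfolding T_def four using s by (simp add: X_simps[simplified] p_simps[simplified] distrib_left)
  have "(\<integral>\<^sup>+\<omega>. ennreal (exp (T \<omega>)) \<partial>M) \<le> ennreal (exp 2)"
    unfolding T_def
  proof (rule exp_moment_subconvex_combination)
    show "sum p {..<4} \<le> 1"
      unfolding four using s by (simp add: p_simps[simplified] s_def flip: add_divide_distrib)
    have "(\<integral>\<^sup>+\<omega>. ennreal (exp (X1 \<omega>)) \<partial>M) \<le> ennreal (exp 2)"
      using m1 by (rule order_trans) simp
    with m2 m3 m4 show "(\<integral>\<^sup>+\<omega>. ennreal (exp (X j \<omega>)) \<partial>M) \<le> ennreal (exp 2)" if "j \<in> {..<4}" for j
      using that unfolding four by (auto simp: X_simps[simplified])
    show "0 \<le> p j" "X j \<in> borel_measurable M" if "j \<in> {..<4}" for j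
      using that s X_meas unfolding four by (auto simp: p_simps[simplified] X_simps[simplified])
  qed auto
  moreover have [measurable]: "T \<in> borel_measurable M"
    unfolding T_def[abs_def] four by (simp add: X_simps[simplified])
  ultimately have P: "1 - \<delta> \<le> prob {\<omega>\<in>space M. T \<omega> \<le> 2 + ln (1 / \<delta>)}"
    using \<delta> by (intro exp_moment_imp_tail) auto

  define bnd where "bnd = 6 * (1 - \<rho>) ^ t * d
       + (34 * (\<eta> * \<sigma>\<^sup>2) + 52 * ((\<mu> - 2 * \<gamma>) * \<Delta>\<^sup>2 / \<rho>\<^sup>2)) * (2 + ln (1 / \<delta>))"
  \<comment> \<open>Only almost everywhere, since the drift may be infinite on a null set.\<close>
  have "AE \<omega> in M. T \<omega> \<le> 2 + ln (1 / \<delta>) \<longrightarrow> equilibrium_gap f r xbar xhat t \<omega> \<le> ereal bnd"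
    using fin AE_space
  proof eventually_elim
    case (elim \<omega>)
    show ?case
    proof
      assume T: "T \<omega> \<le> 2 + ln (1 / \<delta>)"
      define N where "N i = \<rho> * w i * (z i \<omega> \<bullet> v i \<omega> + \<eta> * (norm (z i \<omega>))\<^sup>2 + (G i \<omega>)\<^sup>2 / m)
          - \<rho> * (1 - \<rho>) ^ (2 * (t - 1 - i) + 1) * (m / 4 * (norm (v i \<omega>))\<^sup>2)" for i
      have gap: "equilibrium_gap f r xbar xhat t \<omega>
          \<le> ereal (3 * (1 - \<rho>) ^ t * (2 * d + 8 * (G 0 \<omega>)\<^sup>2 / \<mu>) + (\<Sum>i<t. N i))"
        using pathwise_gap_bound[OF psg \<eta> r_const[OF elim(2)] elim(2) t _ d[OF elim(2)]] elim(1)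
        unfolding N_def w_def z_def v_def G_def m_def \<rho>_def by blast
      have "N i \<le> s1 * (z i \<omega> \<bullet> y i \<omega> - 2 * (\<sigma>\<^sup>2 * (norm (y i \<omega>))\<^sup>2))
          + s2 * (\<rho> * w i / 2 * ((norm (z i \<omega>))\<^sup>2 / \<sigma>\<^sup>2)) + s3 * (c3 i * (b i * (G i \<omega>)\<^sup>2))"
        if i: "i < t" for i
      proof -
        have "\<rho> * w i * (z i \<omega> \<bullet> v i \<omega>) - \<rho> * (1 - \<rho>) ^ (2 * (t - 1 - i) + 1) * (m / 4 * (norm (v i \<omega>))\<^sup>2)
            \<le> s1 * (z i \<omega> \<bullet> y i \<omega> - 2 * (\<sigma>\<^sup>2 * (norm (y i \<omega>))\<^sup>2))"
          unfolding y_def s1_def w_def using \<rho> \<eta> \<sigma> m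
          by (intro noise_term_le) (auto simp: m_def)
        moreover have "s2 * (\<rho> * w i / 2 * ((norm (z i \<omega>))\<^sup>2 / \<sigma>\<^sup>2)) = \<rho> * w i * (\<eta> * (norm (z i \<omega>))\<^sup>2)"
          using \<sigma> by (simp add: s2_def)
        moreover have "s3 * (c3 i * (b i * (G i \<omega>)\<^sup>2)) = \<rho> * w i * ((G i \<omega>)\<^sup>2 / m)"
        proof -
          have "s3 * c3 i = \<rho> * w i * m * \<Delta>\<^sup>2 * (real (t - i))\<^sup>2" using s by (simp add: c3_def)
          then have "s3 * (c3 i * (b i * (G i \<omega>)\<^sup>2))
              = \<rho> * w i * m * \<Delta>\<^sup>2 * (real (t - i))\<^sup>2 * (b i * (G i \<omega>)\<^sup>2)"
            by (metis mult.assoc)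
          also have "\<dots> = \<rho> * w i * ((G i \<omega>)\<^sup>2 / m)"
            using i m \<Delta> by (simp add: b_def power_mult_distrib) (simp add: power2_eq_square)
          finally show ?thesis .
        qed
        ultimately show ?thesis unfolding N_def by (simp add: distrib_left)
      qed
      then have "(\<Sum>i<t. N i) \<le> (\<Sum>i<t. s1 * (z i \<omega> \<bullet> y i \<omega> - 2 * (\<sigma>\<^sup>2 * (norm (y i \<omega>))\<^sup>2))
          + s2 * (\<rho> * w i / 2 * ((norm (z i \<omega>))\<^sup>2 / \<sigma>\<^sup>2)) + s3 * (c3 i * (b i * (G i \<omega>)\<^sup>2)))"
        by (intro sum_mono) simp
      also have "\<dots> = s1 * X1 \<omega> + s2 * X2 \<omega> + s3 * X3 \<omega>"
        unfolding X1_def X2_def X3_def by (simp only: sum.distrib sum_distrib_left)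
      finally have 1: "(\<Sum>i<t. N i) \<le> s1 * X1 \<omega> + s2 * X2 \<omega> + s3 * X3 \<omega>" .
      \<comment> \<open>Absorbs the drift part of the initial comparison: \<open>24 = 3 * 8\<close>,
        and \<open>1 / \<mu> \<le> 1 / m\<close>.\<close>
      have "24 * (1 - \<rho>) ^ t / \<mu> \<le> s4 * b 0"
      proof -
        have "(1 - \<rho>) ^ t * (real t)\<^sup>2 \<le> 2 / \<rho>\<^sup>2"
          using power_times_square_le[of "1 - \<rho>" t] \<rho> by simp
        then have "(1 - \<rho>) ^ t \<le> 2 / \<rho>\<^sup>2 / (real t)\<^sup>2" using t by (subst pos_le_divide_eq) auto
        then have "24 * (1 - \<rho>) ^ t / \<mu> \<le> 24 * (2 / \<rho>\<^sup>2 / (real t)\<^sup>2) / m"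
          using m \<kappa>[of t] by (intro frac_le) auto
        also have "\<dots> = s4 * b 0"
          using m \<Delta> t \<rho> by (simp add: s4_def b_def power_mult_distrib) (simp add: power2_eq_square)
        finally show ?thesis .
      qed
      then have "24 * (1 - \<rho>) ^ t / \<mu> * (G 0 \<omega>)\<^sup>2 \<le> s4 * b 0 * (G 0 \<omega>)\<^sup>2"
        by (rule mult_right_mono) simp
      then have "3 * (1 - \<rho>) ^ t * (8 * (G 0 \<omega>)\<^sup>2 / \<mu>) \<le> s4 * X4 \<omega>"
        by (simp add: X4_def mult_ac)
      then have "3 * (1 - \<rho>) ^ t * (2 * d + 8 * (G 0 \<omega>)\<^sup>2 / \<mu>) + (\<Sum>i<t. N i)
          \<le> 6 * (1 - \<rho>) ^ t * d + s * T \<omega>"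
        using 1 unfolding T_eq by (simp add: distrib_left)
      also have "s * T \<omega> \<le> s * (2 + ln (1 / \<delta>))" using T s by simp
      also have "s = 34 * (\<eta> * \<sigma>\<^sup>2) + 52 * ((\<mu> - 2 * \<gamma>) * \<Delta>\<^sup>2 / \<rho>\<^sup>2)"
        by (simp add: s_def s1_def s2_def s3_def s4_def m_def)
      finally show "equilibrium_gap f r xbar xhat t \<omega> \<le> ereal bnd"
        unfolding bnd_def by (intro order_trans[OF gap]) simp
    qed
  qed
  then have "prob {\<omega>\<in>space M. T \<omega> \<le> 2 + ln (1 / \<delta>)}
      \<le> prob {\<omega>\<in>space M. equilibrium_gap f r xbar xhat t \<omega> \<le> ereal bnd}"
  proof (intro finite_measure_mono_AE)
    show "{\<omega>\<in>space M. equilibrium_gap f r xbar xhat t \<omega> \<le> ereal bnd} \<in> sets M"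
      using gap_measurable[of t] by measurable
  qed (auto elim: eventually_mono)
  with P show ?thesis unfolding bnd_def by linarith
qed

text \<open>\<open>\<rho> \<ge> m * \<eta> / 2\<close> improves the rate and bounds
  \<open>m * \<Delta>\<^sup>2 / \<rho>\<^sup>2\<close> by four times the drift term; then
  \<open>52 * 4 \<le> 250\<close>, and \<open>1 + l \<le> 2 * l\<close> doubles this to 500.\<close>

lemma gap_constants_le:
  fixes m \<eta> \<rho> \<sigma> \<Delta> d l :: real
  assumes m: "0 < m" and \<eta>: "0 < \<eta>" and \<rho>: "m * \<eta> / 2 \<le> \<rho>" "\<rho> \<le> 1" and d: "0 \<le> d" and l: "1 \<le> l"
  shows "6 * (1 - \<rho>) ^ t * d + (34 * (\<eta> * \<sigma>\<^sup>2) + 52 * (m * \<Delta>\<^sup>2 / \<rho>\<^sup>2)) * (1 + l)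
    \<le> 500 * ((1 - m * \<eta> / 2) ^ t * d + (\<eta> * \<sigma>\<^sup>2 + \<Delta>\<^sup>2 / (m * \<eta>\<^sup>2))) * l"
proof -
  define A B C where "A = (1 - m * \<eta> / 2) ^ t * d" and "B = \<eta> * \<sigma>\<^sup>2" and "C = \<Delta>\<^sup>2 / (m * \<eta>\<^sup>2)"
  have pos: "0 \<le> A" "0 \<le> B" "0 \<le> C" using m \<eta> \<rho> d by (auto simp: A_def B_def C_def)
  have "(1 - \<rho>) ^ t * d \<le> A"
    unfolding A_def using \<rho> d by (intro mult_right_mono power_mono) auto
  moreover have "A \<le> A * l" using pos l by (simp add: mult_le_cancel_left1)
  ultimately have 1: "6 * (1 - \<rho>) ^ t * d \<le> 500 * (A * l)" using pos(1) by linarith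
  have "0 < m * \<eta> / 2" using m \<eta> by simp
  then have "m * \<Delta>\<^sup>2 / \<rho>\<^sup>2 \<le> m * \<Delta>\<^sup>2 / (m * \<eta> / 2)\<^sup>2"
    using m \<rho> by (intro divide_left_mono power_mono mult_pos_pos) auto
  also have "\<dots> = 4 * C" using m \<eta> by (simp add: C_def field_simps power2_eq_square)
  finally have "(34 * B + 52 * (m * \<Delta>\<^sup>2 / \<rho>\<^sup>2)) * (1 + l) \<le> (34 * B + 52 * (4 * C)) * (2 * l)"
    using pos l by (intro mult_mono add_left_mono mult_left_mono) auto
  also have "\<dots> \<le> 250 * (B + C) * (2 * l)"
    using pos l by (intro mult_right_mono) auto
  finally show ?thesis using 1 unfolding A_def[symmetric] B_def[symmetric] C_def[symmetric]
    by (simp add: algebra_simps)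
qed

theorem theorem21:
  shows "\<exists>c::real. 0 < c \<and> c \<le> 10 ^ 6 \<and>
    (\<forall>(M :: 'w measure) F \<mu> L \<gamma> (f :: 'w \<Rightarrow> nat \<Rightarrow> 'a::euclidean_space \<Rightarrow> 'a \<Rightarrow> real) r \<eta>
        x xhat xbar g (\<Delta> :: real) (\<sigma> :: real).
      averaged_decision_dependent_psg M F \<mu> L \<gamma> f r (\<lambda>_. \<eta>) x xhat xbar g \<and>
      0 < \<eta> \<and> \<eta> \<le> 1 / (2 * L) \<and>
      (\<forall>\<omega>\<in>space M. \<forall>s t. r \<omega> s = r \<omega> t) \<and>
      0 < \<Delta> \<and> 0 < \<sigma> \<and>
      (\<forall>i t. i < t \<longrightarrow>
        (\<forall>\<theta>::real. 0 \<le> \<theta> \<and> \<theta> \<le> 1 / ((\<mu> - 2 * \<gamma>) * \<Delta> * \<bar>real i - real t\<bar>)\<^sup>2 \<longrightarrow>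
          (\<integral>\<^sup>+ \<omega>. exp_ennreal (ennreal \<theta> * (gradient_drift f i t \<omega>)\<^sup>2) \<partial>M)
            \<le> ennreal (exp (\<theta> * ((\<mu> - 2 * \<gamma>) * \<Delta> * \<bar>real i - real t\<bar>)\<^sup>2)))) \<and>
      (\<forall>i t. i < t \<longrightarrow>
        (AE \<omega> in M. vec_cond_exp M (sigma_join (F i) (xbar t)) (gradient_noise f x g i) \<omega> = 0) \<and>
        (\<forall>\<tau>>0. AE \<omega> in M.
          conditional_prob M (sigma_join (F i) (xbar t))
              {\<omega>' \<in> space M. \<tau> \<le> norm (gradient_noise f x g i \<omega>')} \<omega>
            \<le> 2 * exp (- 2 * \<tau>\<^sup>2 / \<sigma>\<^sup>2)))
      \<longrightarrow>
      (\<forall>t::nat. \<forall>\<delta>::real. 0 < \<delta> \<and> \<delta> < 1 \<longrightarrow>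
        measure M {\<omega> \<in> space M.
            equilibrium_gap f r xbar xhat t \<omega>
              \<le> ereal c *
                 (ereal ((1 - (\<mu> - 2 * \<gamma>) * \<eta> / 2) ^ t) * equilibrium_gap f r xbar x 0 \<omega>
                   + ereal (\<eta> * \<sigma>\<^sup>2 + \<Delta>\<^sup>2 / ((\<mu> - 2 * \<gamma>) * \<eta>\<^sup>2))) *
                 ereal (ln (exp 1 / \<delta>))}
          \<ge> 1 - \<delta>))"
proof (intro exI[of _ 500] conjI allI impI)
  fix M :: "'w measure" and F \<mu> L \<gamma> and f :: "'w \<Rightarrow> nat \<Rightarrow> 'a::euclidean_space \<Rightarrow> 'a \<Rightarrow> real"
    and r \<eta> x xhat xbar g and \<Delta> \<sigma> :: real and t :: nat and \<delta> :: real
  assume H: "averaged_decision_dependent_psg M F \<mu> L \<gamma> f r (\<lambda>_. \<eta>) x xhat xbar g \<and>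
      0 < \<eta> \<and> \<eta> \<le> 1 / (2 * L) \<and>
      (\<forall>\<omega>\<in>space M. \<forall>s t. r \<omega> s = r \<omega> t) \<and>
      0 < \<Delta> \<and> 0 < \<sigma> \<and>
      (\<forall>i t. i < t \<longrightarrow>
        (\<forall>\<theta>::real. 0 \<le> \<theta> \<and> \<theta> \<le> 1 / ((\<mu> - 2 * \<gamma>) * \<Delta> * \<bar>real i - real t\<bar>)\<^sup>2 \<longrightarrow>
          (\<integral>\<^sup>+ \<omega>. exp_ennreal (ennreal \<theta> * (gradient_drift f i t \<omega>)\<^sup>2) \<partial>M)
            \<le> ennreal (exp (\<theta> * ((\<mu> - 2 * \<gamma>) * \<Delta> * \<bar>real i - real t\<bar>)\<^sup>2)))) \<and>
      (\<forall>i t. i < t \<longrightarrow>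
        (AE \<omega> in M. vec_cond_exp M (sigma_join (F i) (xbar t)) (gradient_noise f x g i) \<omega> = 0) \<and>
        (\<forall>\<tau>>0. AE \<omega> in M.
          conditional_prob M (sigma_join (F i) (xbar t))
              {\<omega>' \<in> space M. \<tau> \<le> norm (gradient_noise f x g i \<omega>')} \<omega>
            \<le> 2 * exp (- 2 * \<tau>\<^sup>2 / \<sigma>\<^sup>2)))"
    and \<delta>: "0 < \<delta> \<and> \<delta> < 1"
  then have psg: "averaged_decision_dependent_psg M F \<mu> L \<gamma> f r (\<lambda>_. \<eta>) x xhat xbar g"
    and \<eta>: "0 < \<eta>" "\<eta> \<le> 1 / (2 * L)" and r_const: "\<And>\<omega> s t. \<omega> \<in> space M \<Longrightarrow> r \<omega> s = r \<omega> t"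
    and \<Delta>: "0 < \<Delta>" and \<sigma>: "0 < \<sigma>" by auto
  have drift: "(\<integral>\<^sup>+ \<omega>. exp_ennreal (ennreal \<theta> * (gradient_drift f i t \<omega>)\<^sup>2) \<partial>M)
      \<le> ennreal (exp (\<theta> * ((\<mu> - 2 * \<gamma>) * \<Delta> * \<bar>real i - real t\<bar>)\<^sup>2))"
    if "i < t" "0 \<le> \<theta>" "\<theta> \<le> 1 / ((\<mu> - 2 * \<gamma>) * \<Delta> * \<bar>real i - real t\<bar>)\<^sup>2" for i \<theta>
    using H that by blast
  have mean: "AE \<omega> in M. vec_cond_exp M (sigma_join (F i) (xbar t)) (gradient_noise f x g i) \<omega> = 0"
    if "i < t" for i using H that by blast
  have tail: "AE \<omega> in M. conditional_prob M (sigma_join (F i) (xbar t))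
      {\<omega>' \<in> space M. \<tau> \<le> norm (gradient_noise f x g i \<omega>')} \<omega> \<le> 2 * exp (- 2 * \<tau>\<^sup>2 / \<sigma>\<^sup>2)"
    if "i < t" "0 < \<tau>" for i \<tau> using H that by blast
  interpret averaged_decision_dependent_psg M F \<mu> L \<gamma> f r "\<lambda>_. \<eta>" x xhat xbar g by (rule psg)
  define m where "m = \<mu> - 2 * \<gamma>"
  define \<rho> where "\<rho> = (\<mu> - 2 * \<gamma>) * \<eta> / (2 - \<mu> * \<eta>)"
  obtain \<omega>0 where \<omega>0: "\<omega>0 \<in> space M" using not_empty by blast
  have \<gamma>: "0 \<le> \<gamma>" by (rule gradient_sensitivityD(2)[OF gamma_eq \<omega>0])
  have m: "0 < m" using gamma_less by (simp add: m_def)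
  have "\<mu> * \<eta> \<le> 1 / 2"
    by (rule strong_convexity_step_size_le[OF loss_strongly_convex[OF \<omega>0] loss_smooth[OF \<omega>0] L_pos \<eta>])
  note \<rho> = averaging_weight_bounds[OF \<gamma> gamma_less \<eta>(1) this, folded \<rho>_def m_def]
  define l where "l = ln (exp 1 / \<delta>)"
  have l_eq: "l = 1 + ln (1 / \<delta>)" using \<delta> by (simp add: l_def ln_div)
  then have l: "1 \<le> l" using \<delta> by simp
  obtain D where D: "\<And>\<omega>. \<omega> \<in> space M \<Longrightarrow> equilibrium_gap f r xbar x 0 \<omega> = D"
    using initial_gap_deterministic by blast
  have D0: "0 \<le> D"
    using equilibrium_gap_nonneg[where f = f and r = r and t = 0 and \<omega> = \<omega>0 and xbar = xbar and y = x,
        OF xbar_equilibrium[OF \<omega>0] regularizer[OF \<omega>0]] D[OF \<omega>0] by simp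
  define A where "A = (1 - m * \<eta> / 2) ^ t"
  define B where "B = \<eta> * \<sigma>\<^sup>2 + \<Delta>\<^sup>2 / (m * \<eta>\<^sup>2)"
  have A: "0 < A" using \<rho> by (simp add: A_def)
  have B: "0 \<le> B" using \<eta> m by (simp add: B_def)
  have "1 - \<delta> \<le> prob {\<omega> \<in> space M. equilibrium_gap f r xbar xhat t \<omega>
      \<le> ereal 500 * (ereal A * D + ereal B) * ereal l}"
  \<comment> \<open>The initial gap may be infinite, namely when \<open>x 0\<close> lies outside the
    domain of the regularizer; the bound is then infinite and holds everywhere.\<close>
  proof (cases D)
    case PInf
    then have top: "ereal 500 * (ereal A * D + ereal B) * ereal l = \<infinity>" using A l by simp
    show ?thesis unfolding top using \<delta> by (simp add: prob_space)
  next
    case (real d)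
    have d: "0 \<le> d" using D0 real by simp
    have rhs: "ereal 500 * (ereal A * D + ereal B) * ereal l = ereal (500 * (A * d + B) * l)"
      by (simp add: real)
    show ?thesis
    \<comment> \<open>At time 0 the average is \<open>x 0\<close> itself and no earlier index exists
      from which a drift could be measured.\<close>
    proof (cases "t = 0")
      case True
      have "d \<le> (d + B) * l" using d B l mult_mono[of d "d + B" 1 l] by simp
      also have "\<dots> \<le> 500 * (A * d + B) * l" using True d B l by (simp add: A_def)
      finally have "equilibrium_gap f r xbar xhat t \<omega> \<le> ereal (500 * (A * d + B) * l)"
        if "\<omega> \<in> space M" for \<omega>
        using D[OF that] xhat_0[OF that] that True
        by (simp add: real equilibrium_gap_def)
      then have "{\<omega> \<in> space M. equilibrium_gap f r xbar xhat t \<omega> \<le> ereal (500 * (A * d + B) * l)} = space M"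
        by auto
      then show ?thesis using \<delta> unfolding rhs by (simp add: prob_space)
    next
      case False
      define bnd where "bnd = 6 * (1 - \<rho>) ^ t * d
        + (34 * (\<eta> * \<sigma>\<^sup>2) + 52 * (m * \<Delta>\<^sup>2 / \<rho>\<^sup>2)) * (2 + ln (1 / \<delta>))"
      have "1 - \<delta> \<le> prob {\<omega> \<in> space M. equilibrium_gap f r xbar xhat t \<omega> \<le> ereal bnd}"
        unfolding bnd_def \<rho>_def m_def
      proof (rule high_probability_gap_bound[OF psg \<eta> r_const _ \<Delta> \<sigma>])
        fix i assume i: "i < t"
        then have abs: "\<bar>real i - real t\<bar> = real (t - i)" by simp
        have pos: "0 < ((\<mu> - 2 * \<gamma>) * \<Delta> * real (t - i))\<^sup>2" using m \<Delta> i by (simp add: m_def)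
        \<comment> \<open>The drift assumption is applied at its largest admissible exponent, where
          its bound is \<open>exp 1\<close>.\<close>
        have inv: "1 / q * q = 1" "0 \<le> 1 / q" if "0 < q" for q :: real using that by auto
        show "(\<integral>\<^sup>+ \<omega>. exp_ennreal (ennreal (1 / ((\<mu> - 2 * \<gamma>) * \<Delta> * real (t - i))\<^sup>2)
          * (gradient_drift f i t \<omega>)\<^sup>2) \<partial>M) \<le> ennreal (exp 1)"
          using drift[OF i inv(2)[OF pos], unfolded abs, OF order_refl] unfolding inv(1)[OF pos] .
        show "AE \<omega> in M. vec_cond_exp M (sigma_join (F i) (xbar t)) (gradient_noise f x g i) \<omega> = 0"
          by (rule mean[OF i])
        fix \<tau> :: real assume "0 < \<tau>"
        then show "AE \<omega> in M. conditional_prob M (sigma_join (F i) (xbar t))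
            {\<omega>' \<in> space M. \<tau> \<le> norm (gradient_noise f x g i \<omega>')} \<omega> \<le> 2 * exp (- 2 * \<tau>\<^sup>2 / \<sigma>\<^sup>2)"
          by (rule tail[OF i])
      next
        show "equilibrium_gap f r xbar x 0 \<omega> = ereal d" if "\<omega> \<in> space M" for \<omega>
          using D[OF that] real by simp
      qed (use \<delta> False in auto)
      also have "\<dots> \<le> prob {\<omega> \<in> space M. equilibrium_gap f r xbar xhat t \<omega> \<le> ereal (500 * (A * d + B) * l)}"
      proof (rule finite_measure_mono)
        have ln_eq: "2 + ln (1 / \<delta>) = 1 + l" by (simp add: l_eq)
        have "bnd \<le> 500 * (A * d + B) * l"
          unfolding bnd_def A_def B_def ln_eq
          using \<rho>(4) by (intro gap_constants_le[OF m \<eta>(1) \<rho>(2) _ d l]) simp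
        then show "{\<omega> \<in> space M. equilibrium_gap f r xbar xhat t \<omega> \<le> ereal bnd}
          \<subseteq> {\<omega> \<in> space M. equilibrium_gap f r xbar xhat t \<omega> \<le> ereal (500 * (A * d + B) * l)}"
          by (auto intro: order_trans)
        show "{\<omega> \<in> space M. equilibrium_gap f r xbar xhat t \<omega> \<le> ereal (500 * (A * d + B) * l)} \<in> sets M"
          using gap_measurable[of t] by measurable
      qed
      finally show ?thesis unfolding rhs .
    qed
  qed (use D0 in simp)
  also have "{\<omega> \<in> space M. equilibrium_gap f r xbar xhat t \<omega>
      \<le> ereal 500 * (ereal A * D + ereal B) * ereal l}
    = {\<omega> \<in> space M. equilibrium_gap f r xbar xhat t \<omega>
      \<le> ereal 500 * (ereal A * equilibrium_gap f r xbar x 0 \<omega> + ereal B) * ereal l}"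
    using D by auto
  finally show "1 - \<delta> \<le> measure M {\<omega> \<in> space M.
            equilibrium_gap f r xbar xhat t \<omega>
              \<le> ereal 500 *
                 (ereal ((1 - (\<mu> - 2 * \<gamma>) * \<eta> / 2) ^ t) * equilibrium_gap f r xbar x 0 \<omega>
                   + ereal (\<eta> * \<sigma>\<^sup>2 + \<Delta>\<^sup>2 / ((\<mu> - 2 * \<gamma>) * \<eta>\<^sup>2))) *
                 ereal (ln (exp 1 / \<delta>))}"
    unfolding A_def B_def m_def l_def .
qed simp_all

end
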